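(* Let $\mathbf{B}'_4$ be the commutator subgroup of the braid group $\mathbf{B}_4$ and let $\mathbf{J}_4=\mathbf{B}'_4\cap\mathbf{P}_4$, where $\mathbf{P}_4\subset\mathbf{B}_4$ is the pure braid group. Then $\mathbf{J}_4$ is a characteristic subgroup of $\mathbf{B}'_4$, that is, it is invariant under every automorphism of $\mathbf{B}'_4$.
   Context: $\mathbf{B}_n$ is the group generated by $\sigma_1,\dots,\sigma_{n-1}$ subject to $\sigma_i\sigma_j=\sigma_j\sigma_i$ for $|i-j|>1$ and $\sigma_i\sigma_j\sigma_i=\sigma_j\sigma_i\sigma_j$ for $|i-j|=1$. $\mathbf{P}_n$ is the kernel of the homomorphism from $\mathbf{B}_n$ to the symmetric group on $\{1,\dots,n\}$ which takes $\sigma_i$ to the transposition $(i,i+1)$. *)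

theory Defs
  imports "HOL-Algebra.Sym_Groups" "HOL-Algebra.Bij"
begin

section \<open>Groups given by generators and relations\<close>

text \<open>The letter \<open>(g, True)\<close> stands for the generator \<open>g\<close>, the letter \<open>(g, False)\<close> for its inverse.
  A pair \<open>(u, v)\<close> of words is the relation \<open>u = v\<close>.\<close>

type_synonym 'g word = "('g \<times> bool) list"

definition words :: "'g set \<Rightarrow> 'g word set" where
  "words S = lists (S \<times> UNIV)"

inductive word_equiv :: "'g set \<Rightarrow> ('g word \<times> 'g word) set \<Rightarrow> 'g word \<Rightarrow> 'g word \<Rightarrow> bool"
  for S R where
  refl: "w \<in> words S \<Longrightarrow> word_equiv S R w w"
| sym: "word_equiv S R u v \<Longrightarrow> word_equiv S R v u"
| trans: "word_equiv S R u v \<Longrightarrow> word_equiv S R v w \<Longrightarrow> word_equiv S R u w"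
| append: "word_equiv S R u u' \<Longrightarrow> word_equiv S R v v' \<Longrightarrow> word_equiv S R (u @ v) (u' @ v')"
| cancel: "g \<in> S \<Longrightarrow> word_equiv S R [(g, b), (g, \<not> b)] []"
| rel: "(u, v) \<in> R \<Longrightarrow> u \<in> words S \<Longrightarrow> v \<in> words S \<Longrightarrow> word_equiv S R u v"

definition word_class :: "'g set \<Rightarrow> ('g word \<times> 'g word) set \<Rightarrow> 'g word \<Rightarrow> 'g word set" where
  "word_class S R u = {v. word_equiv S R u v}"

definition presented_group :: "'g set \<Rightarrow> ('g word \<times> 'g word) set \<Rightarrow> 'g word set monoid" where
  "presented_group S R =
    \<lparr>carrier = word_class S R ` words S,
     mult = (\<lambda>A B. \<Union>u\<in>A. \<Union>v\<in>B. word_class S R (u @ v)),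
     one = word_class S R []\<rparr>"

definition generator :: "'g set \<Rightarrow> ('g word \<times> 'g word) set \<Rightarrow> 'g \<Rightarrow> 'g word set" where
  "generator S R g = word_class S R [(g, True)]"

primrec word_eval :: "('a, 'b) monoid_scheme \<Rightarrow> ('g \<Rightarrow> 'a) \<Rightarrow> 'g word \<Rightarrow> 'a" where
  "word_eval G f [] = \<one>\<^bsub>G\<^esub>"
| "word_eval G f (l # w) =
    (if snd l then f (fst l) else inv\<^bsub>G\<^esub> (f (fst l))) \<otimes>\<^bsub>G\<^esub> word_eval G f w"

text \<open>The map induced by \<open>f\<close> on classes of words; it is well defined, and then the unique
  homomorphism extending \<open>f\<close>, as soon as \<open>f\<close> respects the relations
  (\<open>induced_hom_in_hom\<close>, \<open>hom_eq_on_generators\<close> below).\<close>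

definition induced_hom :: "('a, 'b) monoid_scheme \<Rightarrow> ('g \<Rightarrow> 'a) \<Rightarrow> 'g word set \<Rightarrow> 'a" where
  "induced_hom G f A = the_elem (word_eval G f ` A)"

lemma words_simps [simp]:
  "[] \<in> words S" "l # w \<in> words S \<longleftrightarrow> fst l \<in> S \<and> w \<in> words S"
  "u @ v \<in> words S \<longleftrightarrow> u \<in> words S \<and> v \<in> words S"
  by (auto simp: words_def mem_Times_iff)

lemma word_equiv_words: "word_equiv S R u v \<Longrightarrow> u \<in> words S \<and> v \<in> words S"
  by (induction rule: word_equiv.induct) auto

lemma word_class_eq_iff:
  "u \<in> words S \<Longrightarrow> word_class S R u = word_class S R v \<longleftrightarrow> word_equiv S R u v"
  unfolding word_class_def set_eq_iff mem_Collect_eq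
  by (metis word_equiv.refl word_equiv.sym word_equiv.trans word_equiv_words)

lemma presented_mult:
  assumes "u \<in> words S" "v \<in> words S"
  shows "word_class S R u \<otimes>\<^bsub>presented_group S R\<^esub> word_class S R v = word_class S R (u @ v)"
proof -
  have "word_class S R (u' @ v') = word_class S R (u @ v)"
    if "u' \<in> word_class S R u" "v' \<in> word_class S R v" for u' v'
  proof -
    have "word_equiv S R (u @ v) (u' @ v')"
      using that by (simp add: word_class_def word_equiv.append)
    then show ?thesis using word_class_eq_iff[of "u @ v" S R "u' @ v'"] assms by simp
  qed
  then have "(\<Union>u'\<in>word_class S R u. \<Union>v'\<in>word_class S R v. word_class S R (u' @ v')) =
      (\<Union>u'\<in>word_class S R u. \<Union>v'\<in>word_class S R v. word_class S R (u @ v))"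
    by (intro SUP_cong HOL.refl)
  moreover have "word_class S R u \<noteq> {}" "word_class S R v \<noteq> {}"
    using assms by (auto simp: word_class_def intro: word_equiv.refl)
  ultimately show ?thesis
    by (simp add: presented_group_def)
qed

lemma word_inverse:
  "u \<in> words S \<Longrightarrow> \<exists>v\<in>words S. word_equiv S R (v @ u) []"
proof (induction u)
  case Nil
  show ?case by (rule bexI[of _ "[]"]) (auto intro: word_equiv.refl)
next
  case (Cons l u)
  obtain g b where l: "l = (g, b)" by force
  from Cons obtain v where v: "v \<in> words S" "word_equiv S R (v @ u) []" and g: "g \<in> S" "u \<in> words S"
    by (auto simp: l)
  have "word_equiv S R ([(g, \<not> b), (g, b)] @ u) ([] @ u)"
    using g word_equiv.cancel[of g S R "\<not> b"] by (intro word_equiv.append word_equiv.refl) auto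
  with v(1) have "word_equiv S R (v @ ([(g, \<not> b), (g, b)] @ u)) (v @ ([] @ u))"
    by (rule word_equiv.append[OF word_equiv.refl])
  then have "word_equiv S R ((v @ [(g, \<not> b)]) @ (l # u)) []"
    using v(2) by (auto simp: l intro: word_equiv.trans)
  then show ?case using v g by (intro bexI[of _ "v @ [(g, \<not> b)]"]) auto
qed

lemma group_presented_group: "group (presented_group S R)"
proof (rule groupI)
  let ?P = "presented_group S R"
  have car: "carrier ?P = word_class S R ` words S" and one: "\<one>\<^bsub>?P\<^esub> = word_class S R []"
    by (simp_all add: presented_group_def)
  show "x \<otimes>\<^bsub>?P\<^esub> y \<in> carrier ?P" if "x \<in> carrier ?P" "y \<in> carrier ?P" for x y
    using that by (auto simp: car presented_mult)
  show "\<one>\<^bsub>?P\<^esub> \<in> carrier ?P" by (simp add: car one)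
  show "x \<otimes>\<^bsub>?P\<^esub> y \<otimes>\<^bsub>?P\<^esub> z = x \<otimes>\<^bsub>?P\<^esub> (y \<otimes>\<^bsub>?P\<^esub> z)"
    if "x \<in> carrier ?P" "y \<in> carrier ?P" "z \<in> carrier ?P" for x y z
    using that by (auto simp: car presented_mult)
  show "\<one>\<^bsub>?P\<^esub> \<otimes>\<^bsub>?P\<^esub> x = x" if "x \<in> carrier ?P" for x
    using that by (auto simp: car one presented_mult)
  show "\<exists>y\<in>carrier ?P. y \<otimes>\<^bsub>?P\<^esub> x = \<one>\<^bsub>?P\<^esub>" if x: "x \<in> carrier ?P" for x
  proof -
    from x obtain u where u: "u \<in> words S" "x = word_class S R u" by (auto simp: car)
    obtain v where v: "v \<in> words S" "word_equiv S R (v @ u) []"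
      using word_inverse[OF u(1)] by blast
    show ?thesis
      by (rule bexI[of _ "word_class S R v"])
        (use u v in \<open>auto simp: car one presented_mult word_class_eq_iff\<close>)
  qed
qed

context
  fixes G :: "('a, 'b) monoid_scheme" and S :: "'g set" and f
  assumes G: "group G" and f: "f ` S \<subseteq> carrier G"
begin

interpretation G: group G by (rule G)

lemma word_eval_closed: "w \<in> words S \<Longrightarrow> word_eval G f w \<in> carrier G"
  using f by (induction w) auto

lemma word_eval_append:
  "u \<in> words S \<Longrightarrow> v \<in> words S \<Longrightarrow> word_eval G f (u @ v) = word_eval G f u \<otimes>\<^bsub>G\<^esub> word_eval G f v"
proof (induction u)
  case (Cons l u)
  have "f (fst l) \<in> carrier G" using Cons f by auto
  then show ?case using Cons by (auto simp: G.m_assoc word_eval_closed)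
qed (simp add: word_eval_closed)

context
  fixes R
  assumes R: "\<And>u v. (u, v) \<in> R \<Longrightarrow> u \<in> words S \<Longrightarrow> v \<in> words S \<Longrightarrow> word_eval G f u = word_eval G f v"
begin

lemma word_eval_equiv: "word_equiv S R u v \<Longrightarrow> word_eval G f u = word_eval G f v"
proof (induction rule: word_equiv.induct)
  case (append u u' v v')
  then show ?case by (simp add: word_eval_append word_equiv_words)
next
  case (cancel g b)
  then have "f g \<in> carrier G" using f by auto
  then show ?case by auto
qed (auto intro: R)

lemma induced_hom_class:
  assumes "w \<in> words S"
  shows "induced_hom G f (word_class S R w) = word_eval G f w"
proof -
  have "word_eval G f ` word_class S R w = {word_eval G f w}"
    using assms word_eval_equiv by (fastforce simp: word_class_def intro: word_equiv.refl)
  then show ?thesis by (simp add: induced_hom_def)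
qed

lemma induced_hom_in_hom: "induced_hom G f \<in> hom (presented_group S R) G"
proof (rule homI)
  have car: "carrier (presented_group S R) = word_class S R ` words S"
    by (simp add: presented_group_def)
  show "induced_hom G f x \<in> carrier G" if "x \<in> carrier (presented_group S R)" for x
    using that by (auto simp: car induced_hom_class word_eval_closed)
  show "induced_hom G f (x \<otimes>\<^bsub>presented_group S R\<^esub> y) = induced_hom G f x \<otimes>\<^bsub>G\<^esub> induced_hom G f y"
    if "x \<in> carrier (presented_group S R)" "y \<in> carrier (presented_group S R)" for x y
    using that by (auto simp: car presented_mult induced_hom_class word_eval_append)
qed

lemma induced_hom_generator:
  assumes "g \<in> S"
  shows "induced_hom G f (generator S R g) = f g"
proof -
  have "f g \<in> carrier G" using assms f by blast
  then show ?thesis using assms by (simp add: generator_def induced_hom_class)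
qed

end

end

lemma hom_eq_on_generators:
  assumes G: "group G"
    and h: "h \<in> hom (presented_group S R) G" and k: "k \<in> hom (presented_group S R) G"
    and eq: "\<And>g. g \<in> S \<Longrightarrow> h (generator S R g) = k (generator S R g)"
    and x: "x \<in> carrier (presented_group S R)"
  shows "h x = k x"
proof -
  let ?P = "presented_group S R"
  interpret P: group ?P by (rule group_presented_group)
  interpret h: group_hom ?P G h by (simp add: group_hom_def group_hom_axioms_def G h P.is_group)
  interpret k: group_hom ?P G k by (simp add: group_hom_def group_hom_axioms_def G k P.is_group)
  have car: "word_class S R w \<in> carrier ?P" if "w \<in> words S" for w
    using that by (simp add: presented_group_def)
  have inv: "word_class S R [(g, False)] = inv\<^bsub>?P\<^esub> generator S R g" if g: "g \<in> S" for g
  proof (rule P.inv_equality[symmetric])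
    show "word_class S R [(g, False)] \<otimes>\<^bsub>?P\<^esub> generator S R g = \<one>\<^bsub>?P\<^esub>"
      using g word_equiv.cancel[of g S R False]
      by (simp add: generator_def presented_mult word_class_eq_iff presented_group_def[THEN arg_cong[where f = one]])
  qed (use g car in \<open>auto simp: generator_def\<close>)
  have "h (word_class S R w) = k (word_class S R w)" if "w \<in> words S" for w
    using that
  proof (induction w)
    case Nil
    have "word_class S R [] = \<one>\<^bsub>?P\<^esub>" by (simp add: presented_group_def)
    then show ?case by simp
  next
    case (Cons l w)
    obtain g b where l: "l = (g, b)" by force
    have g: "g \<in> S" "w \<in> words S" using Cons l by auto
    have 1: "h (word_class S R [l]) = k (word_class S R [l])"
      using g eq[OF g(1)] car[of "[(g, True)]"] inv[OF g(1)]
      by (cases b) (auto simp: l generator_def)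
    have "word_class S R (l # w) = word_class S R [l] \<otimes>\<^bsub>?P\<^esub> word_class S R w"
      using presented_mult[of "[l]" S w R] g by (simp add: l)
    then show ?case using 1 Cons g car[of "[l]"] car[of w] by (simp add: l)
  qed
  then show ?thesis using x by (auto simp: presented_group_def)
qed


section \<open>Braid groups\<close>

definition braid_relations :: "nat \<Rightarrow> (nat word \<times> nat word) set" where
  "braid_relations n =
    {([(i, True), (j, True)], [(j, True), (i, True)]) | i j.
        i \<in> {1..<n} \<and> j \<in> {1..<n} \<and> \<bar>int i - int j\<bar> > 1} \<union>
    {([(i, True), (j, True), (i, True)], [(j, True), (i, True), (j, True)]) | i j.
        i \<in> {1..<n} \<and> j \<in> {1..<n} \<and> \<bar>int i - int j\<bar> = 1}"

definition braid_group :: "nat \<Rightarrow> nat word set monoid" where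
  "braid_group n = presented_group {1..<n} (braid_relations n)"

definition braid_perm :: "nat \<Rightarrow> nat word set \<Rightarrow> nat \<Rightarrow> nat" where
  "braid_perm n = induced_hom (sym_group n) (\<lambda>i. transpose i (Suc i))"

definition pure_braid_group :: "nat \<Rightarrow> nat word set set" where
  "pure_braid_group n = kernel (braid_group n) (sym_group n) (braid_perm n)"

lemma transpose_carrier: "(\<lambda>i. transpose i (Suc i)) ` {1..<n} \<subseteq> carrier (sym_group n)"
  by (auto simp: sym_group_carrier intro!: permutes_swap_id)

lemma braid_relations_sym_group:
  assumes "(u, v) \<in> braid_relations n"
  shows "word_eval (sym_group n) (\<lambda>i. transpose i (Suc i)) u =
    word_eval (sym_group n) (\<lambda>i. transpose i (Suc i)) v"
proof -
  let ?t = "\<lambda>i::nat. transpose i (Suc i)"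
  consider i j where "u = [(i, True), (j, True)]" "v = [(j, True), (i, True)]" "\<bar>int i - int j\<bar> > 1"
    | i j where "u = [(i, True), (j, True), (i, True)]" "v = [(j, True), (i, True), (j, True)]"
        "\<bar>int i - int j\<bar> = 1"
    using assms unfolding braid_relations_def by blast
  then show ?thesis
  proof cases
    case 1
    then have "?t i \<circ> ?t j = ?t j \<circ> ?t i" by (intro ext) (auto simp: transpose_def)
    with 1 show ?thesis by (simp add: sym_group_def)
  next
    case 2
    then have "j = Suc i \<or> i = Suc j" by linarith
    then have "?t i \<circ> (?t j \<circ> ?t i) = ?t j \<circ> (?t i \<circ> ?t j)"
      by (elim disjE) (auto simp: transpose_def fun_eq_iff)
    with 2 show ?thesis by (simp add: sym_group_def)
  qed
qed

lemma group_braid_group: "group (braid_group n)"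
  by (simp add: braid_group_def group_presented_group)

lemma braid_perm_hom: "braid_perm n \<in> hom (braid_group n) (sym_group n)"
  unfolding braid_perm_def braid_group_def
  by (rule induced_hom_in_hom[OF sym_group_is_group transpose_carrier braid_relations_sym_group])

lemma braid_perm_generator:
  "i \<in> {1..<n} \<Longrightarrow>
    braid_perm n (generator {1..<n} (braid_relations n) i) = transpose i (Suc i)"
  unfolding braid_perm_def
  by (rule induced_hom_generator[OF sym_group_is_group transpose_carrier braid_relations_sym_group])


section \<open>Commutator subgroup and characteristic subgroups\<close>

definition braid_commutator_subgroup :: "nat \<Rightarrow> nat word set set" where
  "braid_commutator_subgroup n = derived (braid_group n) (carrier (braid_group n))"

definition braid_J :: "nat \<Rightarrow> nat word set set" where
  "braid_J n = braid_commutator_subgroup n \<inter> pure_braid_group n"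

definition characteristic_subgroup :: "'a set \<Rightarrow> ('a, 'b) monoid_scheme \<Rightarrow> bool" where
  "characteristic_subgroup H G \<longleftrightarrow> subgroup H G \<and> (\<forall>\<phi>\<in>auto G. \<phi> ` H = H)"

end

theory Submission
  imports Defs "HOL-Algebra.Elementary_Groups" "HOL-Library.Numeral_Type" "HOL-Library.Product_Plus"
    HOL.Rat
begin

text \<open>
  The group \<open>B\<^sub>4'\<close> is generated by \<open>c = \<sigma>\<^sub>3\<sigma>\<^sub>1\<^sup>-\<^sup>1\<close> and \<open>u\<^sub>n = \<sigma>\<^sub>1\<^sup>n\<sigma>\<^sub>2\<sigma>\<^sub>1\<^sup>-\<^sup>n\<^sup>-\<^sup>1\<close>, and
  \<open>J\<^sub>4\<close> is the kernel of the standard homomorphism \<open>\<pi> : B\<^sub>4' \<rightarrow> A\<^sub>4\<close>. For an automorphism \<open>\<phi>\<close> put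
  \<open>f = \<pi>\<phi>\<close>; the goal is that \<open>f\<close> and \<open>\<pi>\<close> are conjugate by an element of \<open>S\<^sub>4\<close>, so that they have
  the same kernel. This is done by comparing the extensions of \<open>S\<^sub>4\<close> to which they lift.

  First, \<open>\<pi>\<close> does not lift to the double cover \<open>GL(2,3) \<rightarrow> S\<^sub>4\<close>, hence neither does \<open>f\<close>. If \<open>f(c)\<close> were
  trivial, then \<open>f\<close> would factor through the free group \<open>B\<^sub>3'\<close> and lift; hence \<open>f(c) \<noteq> 1\<close>.

  Secondly, \<open>\<sigma>\<^sub>i \<mapsto> (s\<^sub>i, e\<^sub>i + e\<^sub>i\<^sub>+\<^sub>1)\<close> defines a lift of \<open>\<pi>\<close> to affine transformations of
  \<open>\<rat>\<^sup>4\<close> under which \<open>B\<^sub>4'\<close> has no fixed point, so \<open>f\<close> has such a lift \<open>h\<close> as well. If \<open>h(c)\<^sup>2\<close> were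
  trivial, then the barycentre of an orbit of the Klein four-group generated by \<open>h(c)\<close> and its
  conjugates would be fixed by \<open>h\<close>. So \<open>h(c)\<^sup>2\<close> is a nonzero translation, and conjugating it by the
  \<open>h(u\<^sub>n)\<close> gives \<open>f(u\<^sub>n\<^sub>+\<^sub>2) = f(u\<^sub>n)\<close>. This determines \<open>f\<close> up to conjugation in \<open>S\<^sub>4\<close>.
\<close>

section \<open>The commutator subgroup of the braid group on four strings\<close>

context group
begin

lemma cancel_inv:
  assumes "x \<in> carrier G" "y \<in> carrier G"
  shows "inv x \<otimes> (x \<otimes> y) = y" "x \<otimes> (inv x \<otimes> y) = y"
  using assms by (simp_all add: m_assoc[symmetric])

lemma commute_inv:
  assumes "x \<in> carrier G" "y \<in> carrier G" "x \<otimes> y = y \<otimes> x"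
  shows "x \<otimes> inv y = inv y \<otimes> x"
proof -
  have "inv y \<otimes> (x \<otimes> y) \<otimes> inv y = inv y \<otimes> (y \<otimes> x) \<otimes> inv y"
    by (simp only: assms(3))
  then show ?thesis
    using assms(1,2) by (simp add: m_assoc cancel_inv)
qed

lemma commute_left:
  assumes "x \<in> carrier G" "y \<in> carrier G" "z \<in> carrier G" "x \<otimes> y = y \<otimes> x"
  shows "x \<otimes> (y \<otimes> z) = y \<otimes> (x \<otimes> z)"
proof -
  have "(x \<otimes> y) \<otimes> z = (y \<otimes> x) \<otimes> z"
    by (simp only: assms(4))
  then show ?thesis
    using assms(1-3) by (simp only: m_assoc)
qed

lemma commute_int_pow:
  fixes n :: int
  assumes "x \<in> carrier G" "y \<in> carrier G" "x \<otimes> y = y \<otimes> x"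
  shows "x \<otimes> y [^] n = y [^] n \<otimes> x"
proof -
  have *: "x \<otimes> y [^] k = y [^] k \<otimes> x" for k :: nat
  proof (induction k)
    case (Suc k)
    have "x \<otimes> (y [^] k \<otimes> y) = y [^] k \<otimes> (x \<otimes> y)"
      using assms(1,2) Suc by (simp only: commute_left nat_pow_closed)
    also have "\<dots> = y [^] k \<otimes> y \<otimes> x"
      using assms(1,2) by (simp only: assms(3) m_assoc nat_pow_closed)
    finally show ?case
      by simp
  qed (use assms(1) in simp)
  show ?thesis
  proof (cases "n < 0")
    case True
    then show ?thesis
      unfolding int_pow_def2
      using commute_inv[OF assms(1) nat_pow_closed[OF assms(2)] *] by (simp only: if_True)
  next
    case False
    then show ?thesis
      unfolding int_pow_def2 using * by (simp only: if_False)
  qed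
qed

end

text \<open>These are the relations of the Reidemeister--Schreier presentation of \<open>B\<^sub>4'\<close> with respect to
  the transversal of powers of \<open>\<sigma>\<^sub>1\<close>.\<close>

definition braid_pair :: "('a, 'b) monoid_scheme \<Rightarrow> 'a \<Rightarrow> (int \<Rightarrow> 'a) \<Rightarrow> bool" where
  "braid_pair H c u \<longleftrightarrow> c \<in> carrier H \<and> range u \<subseteq> carrier H \<and>
    (\<forall>n. u (n + 1) = u n \<otimes>\<^bsub>H\<^esub> u (n + 2)) \<and>
    (\<forall>n. u n \<otimes>\<^bsub>H\<^esub> c \<otimes>\<^bsub>H\<^esub> u (n + 2) = c \<otimes>\<^bsub>H\<^esub> u (n + 1) \<otimes>\<^bsub>H\<^esub> c)"

lemma braid_pair_hom:
  assumes "group H" and h: "h \<in> hom H K" and cu: "braid_pair H c u"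
  shows "braid_pair K (h c) (\<lambda>n. h (u n))"
proof -
  interpret group H by (rule assms)
  have [simp]: "c \<in> carrier H" "u n \<in> carrier H" for n
    using cu by (auto simp: braid_pair_def)
  have "h (u (n + 1)) = h (u n \<otimes>\<^bsub>H\<^esub> u (n + 2))"
    "h (u n \<otimes>\<^bsub>H\<^esub> c \<otimes>\<^bsub>H\<^esub> u (n + 2)) = h (c \<otimes>\<^bsub>H\<^esub> u (n + 1) \<otimes>\<^bsub>H\<^esub> c)" for n
    using cu by (simp_all add: braid_pair_def)
  then show ?thesis
    using hom_in_carrier[OF h] by (auto simp: braid_pair_def hom_mult[OF h])
qed

section \<open>Conjugates of \<open>c\<close> in a group with a braid pair\<close>

context group
begin

text \<open>For a braid pair, \<open>conj_seq_step\<close> puts all these conjugates of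
  \<open>c\<close> into the subgroup generated by \<open>c\<close> and any one of them. Their images
  in the alternating group will lie in the Klein four-group (\<open>A4_pair_V4\<close>).\<close>

definition conj_seq :: "'a \<Rightarrow> (int \<Rightarrow> 'a) \<Rightarrow> int \<Rightarrow> 'a" where
  "conj_seq c u n = inv u n \<otimes> c \<otimes> u n"

context
  fixes c u
  assumes cu: "braid_pair G c u"
begin

lemma braid_pair_closed [simp]: "c \<in> carrier G" "u n \<in> carrier G"
  using cu by (auto simp: braid_pair_def)

lemma conj_seq_closed [simp]: "conj_seq c u n \<in> carrier G"
  by (simp add: conj_seq_def)

text \<open>Multiply the second relation on the left by the inverse of \<open>u (n + 1)\<close>,
  which is \<open>inv u (n + 2) \<otimes> inv u n\<close> by the first relation.\<close>

lemma conj_seq_step: "conj_seq c u (n + 2) = conj_seq c u (n + 1) \<otimes> c"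
proof -
  note [simp] = m_assoc cancel_inv inv_mult_group
  have 1: "u (n + 1) = u n \<otimes> u (n + 2)" and 2: "u n \<otimes> c \<otimes> u (n + 2) = c \<otimes> u (n + 1) \<otimes> c"
    using cu by (auto simp: braid_pair_def)
  have "inv u (n + 1) \<otimes> (u n \<otimes> c \<otimes> u (n + 2)) = inv u (n + 1) \<otimes> (c \<otimes> u (n + 1) \<otimes> c)"
    by (simp only: 2)
  then show ?thesis
    unfolding conj_seq_def by (simp add: 1)
qed

text \<open>By the first relation both sides equal
  \<open>inv u n \<otimes> c \<otimes> u (n + 1)\<close>. Besides \<open>conj_seq_eq\<close> this
  gives a second conjugation by the same element.\<close>

lemma conj_seq_conj: "conj_seq c u n \<otimes> u (n + 2) = u (n + 2) \<otimes> conj_seq c u (n + 1)"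
proof -
  have "u (n + 1) = u n \<otimes> u (n + 2)"
    using cu by (auto simp: braid_pair_def)
  then show ?thesis
    by (simp add: conj_seq_def m_assoc cancel_inv inv_mult_group)
qed

lemma conj_seq_eq: "u n \<otimes> conj_seq c u n = c \<otimes> u n"
  by (simp add: conj_seq_def m_assoc cancel_inv)

text \<open>Two steps at once. Whether conjugates two indices apart agree thus depends only on the
  square of \<open>c\<close>; this is the test made in the double cover and in the affine
  group.\<close>

lemma conj_seq_shift: "conj_seq c u (n + 3) = conj_seq c u (n + 1) \<otimes> (c \<otimes> c)"
  using conj_seq_step[of n] conj_seq_step[of "n + 1"]
  by (simp add: m_assoc add.commute)

end

text \<open>Powers of \<open>a\<close> commute with \<open>a\<close> and \<open>d\<close>, so the
  elements for \<open>n\<close>, \<open>n + 1\<close>, \<open>n + 2\<close> are the conjugates by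
  \<open>a [^] n\<close> of those for \<open>0\<close>, \<open>1\<close>, \<open>2\<close>. Once the
  outer powers cancel, both relations follow from the braid relations.\<close>

lemma braid_pair_of_generators:
  assumes [simp]: "a \<in> carrier G" "b \<in> carrier G" "d \<in> carrier G"
    and ad: "a \<otimes> d = d \<otimes> a" and aba: "a \<otimes> b \<otimes> a = b \<otimes> a \<otimes> b" and dbd: "d \<otimes> b \<otimes> d = b \<otimes> d \<otimes> b"
  shows "braid_pair G (d \<otimes> inv a) (\<lambda>n. a [^] n \<otimes> b \<otimes> inv (a [^] (n + 1)))"
proof -
  define A where "A = inv a"
  have [simp]: "A \<in> carrier G" by (simp add: A_def)
  have cA [simp]: "A \<otimes> a = \<one>" "a \<otimes> A = \<one>" "A \<otimes> (a \<otimes> y) = y" "a \<otimes> (A \<otimes> y) = y"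
    if "y \<in> carrier G" for y
    using that by (simp_all add: A_def cancel_inv)
  have Ad: "d \<otimes> A = A \<otimes> d"
    using ad by (simp add: A_def commute_inv)
  have aba': "b \<otimes> (a \<otimes> (b \<otimes> y)) = a \<otimes> (b \<otimes> (a \<otimes> y))"
    and dbd': "b \<otimes> (d \<otimes> (b \<otimes> y)) = d \<otimes> (b \<otimes> (d \<otimes> y))" if [simp]: "y \<in> carrier G" for y
    using arg_cong[OF aba, of "\<lambda>x. x \<otimes> y"] arg_cong[OF dbd, of "\<lambda>x. x \<otimes> y"]
    by (simp_all add: m_assoc)
  define u where "u = (\<lambda>n::int. a [^] n \<otimes> b \<otimes> inv (a [^] (n + 1)))"
  have u: "u n = P \<otimes> (b \<otimes> (A \<otimes> Q))" "u (n + 1) = P \<otimes> (a \<otimes> (b \<otimes> (A \<otimes> (A \<otimes> Q))))"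
    "u (n + 2) = P \<otimes> (a \<otimes> (a \<otimes> (b \<otimes> (A \<otimes> (A \<otimes> (A \<otimes> Q))))))"
    if P: "P = a [^] n" and Q: "Q = inv P" for n :: int and P Q
  proof -
    have p: "a [^] (n + 1) = P \<otimes> a" "a [^] (n + 2) = P \<otimes> (a \<otimes> a)" "a [^] (n + 3) = P \<otimes> (a \<otimes> (a \<otimes> a))"
    proof -
      show 1: "a [^] (n + 1) = P \<otimes> a"
        by (simp add: int_pow_mult P)
      have "a [^] (n + 1 + 1) = a [^] (n + 1) \<otimes> a" "a [^] (n + 1 + 1 + 1) = a [^] (n + 1) \<otimes> a \<otimes> a"
        by (simp_all only: int_pow_mult assms int_pow_1)
      then show "a [^] (n + 2) = P \<otimes> (a \<otimes> a)" "a [^] (n + 3) = P \<otimes> (a \<otimes> (a \<otimes> a))"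
        using 1 by (simp_all add: m_assoc P add.commute)
    qed
    show "u n = P \<otimes> (b \<otimes> (A \<otimes> Q))" "u (n + 1) = P \<otimes> (a \<otimes> (b \<otimes> (A \<otimes> (A \<otimes> Q))))"
      "u (n + 2) = P \<otimes> (a \<otimes> (a \<otimes> (b \<otimes> (A \<otimes> (A \<otimes> (A \<otimes> Q))))))"
      by (simp_all add: u_def p Q P[symmetric] add.assoc) (simp_all add: P inv_mult_group m_assoc A_def)
  qed
  have "u (n + 1) = u n \<otimes> u (n + 2) \<and>
    u n \<otimes> (d \<otimes> A) \<otimes> u (n + 2) = d \<otimes> A \<otimes> u (n + 1) \<otimes> (d \<otimes> A)" for n
  proof -
    define P where "P = a [^] n"
    define Q where "Q = inv P"
    have [simp]: "P \<in> carrier G" "Q \<in> carrier G" by (simp_all add: P_def Q_def)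
    have [simp]: "P \<otimes> Q = \<one>" "Q \<otimes> P = \<one>" "P \<otimes> (Q \<otimes> y) = y" "Q \<otimes> (P \<otimes> y) = y"
      if "y \<in> carrier G" for y
      using that by (simp_all add: Q_def cancel_inv)
    have aP: "a \<otimes> P = P \<otimes> a" "d \<otimes> P = P \<otimes> d"
      using ad by (simp_all add: P_def commute_int_pow)
    then have AP: "A \<otimes> P = P \<otimes> A"
      using commute_inv[of P a] by (simp add: A_def)
    have Q: "A \<otimes> Q = Q \<otimes> A" "d \<otimes> Q = Q \<otimes> d"
      using aP AP by (simp_all add: Q_def commute_inv)
    note u' = u[OF P_def Q_def]
    \<comment> \<open>These rules move \<open>P\<close> to the left and \<open>Q\<close> to the
      right, where they cancel, and put \<open>d\<close> before \<open>A\<close>.\<close>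
    have PA: "A \<otimes> (P \<otimes> y) = P \<otimes> (A \<otimes> y)" "d \<otimes> (P \<otimes> y) = P \<otimes> (d \<otimes> y)"
      "Q \<otimes> (A \<otimes> y) = A \<otimes> (Q \<otimes> y)" "Q \<otimes> (d \<otimes> y) = d \<otimes> (Q \<otimes> y)"
      "A \<otimes> (d \<otimes> y) = d \<otimes> (A \<otimes> y)" if "y \<in> carrier G" for y
      using that AP aP Q Ad by (simp_all add: commute_left)
    have QA: "Q \<otimes> A = A \<otimes> Q" "Q \<otimes> d = d \<otimes> Q" "A \<otimes> d = d \<otimes> A" using Q Ad by simp_all
    show ?thesis
      unfolding u' by (simp add: m_assoc PA QA aba' dbd')
  qed
  moreover have "range u \<subseteq> carrier G" "d \<otimes> A \<in> carrier G"
    by (auto simp: u_def)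
  ultimately show ?thesis
    unfolding braid_pair_def u_def[symmetric] A_def[symmetric] by blast
qed

end

lemma (in group) generate_conj_closed:
  assumes "S \<subseteq> carrier G" "a \<in> carrier G"
    and S: "\<And>x. x \<in> S \<Longrightarrow> a \<otimes> x \<otimes> inv a \<in> generate G S"
    and "x \<in> generate G S"
  shows "a \<otimes> x \<otimes> inv a \<in> generate G S"
  using assms(4)
proof (induction rule: generate.induct)
  case one
  then show ?case using assms(2) by (simp add: generate.one)
next
  case (incl h)
  then show ?case by (rule S)
next
  case (inv h)
  then have h: "h \<in> carrier G" using assms(1) by auto
  have "inv (a \<otimes> h \<otimes> inv a) \<in> generate G S"
    using S[OF inv] assms(1) by (rule generate_m_inv_closed[rotated])
  then show ?case
    using h assms(2) by (simp add: inv_mult_group m_assoc)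
next
  case (eng x y)
  then have "x \<in> carrier G" "y \<in> carrier G"
    using generate_in_carrier[OF assms(1)] by auto
  then have "a \<otimes> (x \<otimes> y) \<otimes> inv a = (a \<otimes> x \<otimes> inv a) \<otimes> (a \<otimes> y \<otimes> inv a)"
    using assms(2) by (simp add: m_assoc cancel_inv)
  then show ?case using eng by (simp add: generate.eng)
qed

text \<open>The image lies in the derived subgroup of an abelian group. This is applied to exponent
  sums, to the sign and to coordinate sums.\<close>

lemma hom_trivial_on_derived:
  assumes "group G" "comm_group K" "h \<in> hom G K" "x \<in> derived G (carrier G)"
  shows "h x = \<one>\<^bsub>K\<^esub>"
proof -
  interpret K: comm_group K by (rule assms)
  interpret h: group_hom G K h
    using assms by (simp add: group_hom_def group_hom_axioms_def comm_group_def)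
  have "h x \<in> derived K (h ` carrier G)"
    using h.derived_img[of "carrier G"] assms(4) by auto
  then show ?thesis
    using K.derived_eq_singleton[of "h ` carrier G"] by (simp add: image_subset_iff)
qed

section \<open>The group \<open>B4\<close>, its universal property and generators of its commutator
  subgroup\<close>

abbreviation "B4 \<equiv> braid_group 4"
abbreviation "B4' \<equiv> braid_commutator_subgroup 4"
abbreviation "G4 \<equiv> braid_group 4\<lparr>carrier := braid_commutator_subgroup 4\<rparr>"

interpretation B4: group B4 by (rule group_braid_group)

definition sigma1 :: "nat word set" where
  "sigma1 = generator {1..<4} (braid_relations 4) 1"

definition sigma2 :: "nat word set" where
  "sigma2 = generator {1..<4} (braid_relations 4) 2"

definition sigma3 :: "nat word set" where
  "sigma3 = generator {1..<4} (braid_relations 4) 3"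

lemma sigma_closed [simp]:
  "sigma1 \<in> carrier B4" "sigma2 \<in> carrier B4" "sigma3 \<in> carrier B4"
  by (auto simp: braid_group_def presented_group_def generator_def sigma1_def sigma2_def sigma3_def)

lemma sigma_relations:
  "sigma1 \<otimes>\<^bsub>B4\<^esub> sigma3 = sigma3 \<otimes>\<^bsub>B4\<^esub> sigma1"
  "sigma1 \<otimes>\<^bsub>B4\<^esub> sigma2 \<otimes>\<^bsub>B4\<^esub> sigma1 = sigma2 \<otimes>\<^bsub>B4\<^esub> sigma1 \<otimes>\<^bsub>B4\<^esub> sigma2"
  "sigma3 \<otimes>\<^bsub>B4\<^esub> sigma2 \<otimes>\<^bsub>B4\<^esub> sigma3 = sigma2 \<otimes>\<^bsub>B4\<^esub> sigma3 \<otimes>\<^bsub>B4\<^esub> sigma2"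
proof -
  have 1: "word_equiv {1..<4} (braid_relations 4) [(1, True), (3, True)] [(3, True), (1, True)]"
    by (rule word_equiv.rel) (auto simp: braid_relations_def)
  have 2: "word_equiv {1..<4} (braid_relations 4) [(1, True), (2, True), (1, True)] [(2, True), (1, True), (2, True)]"
    by (rule word_equiv.rel) (auto simp: braid_relations_def)
  have 3: "word_equiv {1..<4} (braid_relations 4) [(3, True), (2, True), (3, True)] [(2, True), (3, True), (2, True)]"
    by (rule word_equiv.rel) (auto simp: braid_relations_def)
  show "sigma1 \<otimes>\<^bsub>B4\<^esub> sigma3 = sigma3 \<otimes>\<^bsub>B4\<^esub> sigma1"
    "sigma1 \<otimes>\<^bsub>B4\<^esub> sigma2 \<otimes>\<^bsub>B4\<^esub> sigma1 = sigma2 \<otimes>\<^bsub>B4\<^esub> sigma1 \<otimes>\<^bsub>B4\<^esub> sigma2"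
    "sigma3 \<otimes>\<^bsub>B4\<^esub> sigma2 \<otimes>\<^bsub>B4\<^esub> sigma3 = sigma2 \<otimes>\<^bsub>B4\<^esub> sigma3 \<otimes>\<^bsub>B4\<^esub> sigma2"
    using 1 2 3
    by (simp_all add: braid_group_def generator_def presented_mult word_class_eq_iff
        sigma1_def sigma2_def sigma3_def)
qed

text \<open>The universal property of the presentation: up to exchanging sides, the braid relations
  on three generators are the three equations assumed here.\<close>

lemma B4_hom_exists:
  assumes T: "group T" and abd: "a \<in> carrier T" "b \<in> carrier T" "d \<in> carrier T"
    and ad: "a \<otimes>\<^bsub>T\<^esub> d = d \<otimes>\<^bsub>T\<^esub> a"
    and aba: "a \<otimes>\<^bsub>T\<^esub> b \<otimes>\<^bsub>T\<^esub> a = b \<otimes>\<^bsub>T\<^esub> a \<otimes>\<^bsub>T\<^esub> b"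
    and dbd: "d \<otimes>\<^bsub>T\<^esub> b \<otimes>\<^bsub>T\<^esub> d = b \<otimes>\<^bsub>T\<^esub> d \<otimes>\<^bsub>T\<^esub> b"
  shows "\<exists>h\<in>hom B4 T. h sigma1 = a \<and> h sigma2 = b \<and> h sigma3 = d"
proof -
  interpret T: group T by (rule T)
  define f where "f = (\<lambda>i::nat. if i = 1 then a else if i = 2 then b else d)"
  have f: "f ` {1..<4} \<subseteq> carrier T"
    using abd by (auto simp: f_def)
  have R: "word_eval T f u = word_eval T f v"
    if uv: "(u, v) \<in> braid_relations 4" for u v
  proof -
    have i4: "i = 1 \<or> i = 2 \<or> i = 3" if "i \<in> {1..<4}" for i :: nat
      using that by auto
    consider i j where "i \<in> {1..<4}" "j \<in> {1..<4}" "u = [(i, True), (j, True)]" "v = [(j, True), (i, True)]" "\<bar>int i - int j\<bar> > 1"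
      | i j where "i \<in> {1..<4}" "j \<in> {1..<4}" "u = [(i, True), (j, True), (i, True)]" "v = [(j, True), (i, True), (j, True)]"
        "\<bar>int i - int j\<bar> = 1"
      using uv unfolding braid_relations_def by blast
    then show ?thesis
    proof cases
      case 1
      with i4[of i] i4[of j] show ?thesis
        using ad abd by (auto simp: f_def)
    next
      case 2
      with i4[of i] i4[of j] show ?thesis
        using aba dbd abd by (auto simp: f_def T.m_assoc)
    qed
  qed
  let ?h = "induced_hom T f"
  have "?h \<in> hom B4 T"
    unfolding braid_group_def using induced_hom_in_hom[OF T f R] .
  moreover have "?h sigma1 = a" "?h sigma2 = b" "?h sigma3 = d"
    using induced_hom_generator[OF T f R, where R = "braid_relations 4"]
    unfolding sigma1_def sigma2_def sigma3_def by (auto simp: f_def)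
  ultimately show ?thesis by blast
qed

definition c4 :: "nat word set" where
  "c4 = sigma3 \<otimes>\<^bsub>B4\<^esub> inv\<^bsub>B4\<^esub> sigma1"

definition u4 :: "int \<Rightarrow> nat word set" where
  "u4 n = sigma1 [^]\<^bsub>B4\<^esub> n \<otimes>\<^bsub>B4\<^esub> sigma2 \<otimes>\<^bsub>B4\<^esub> inv\<^bsub>B4\<^esub> (sigma1 [^]\<^bsub>B4\<^esub> (n + 1))"

lemma braid_pair_B4: "braid_pair B4 c4 u4"
  unfolding c4_def u4_def
  by (rule B4.braid_pair_of_generators) (simp_all add: sigma_relations)

lemmas B4_pair_closed [simp] = B4.braid_pair_closed[OF braid_pair_B4]

lemma commutator_in_B4':
  assumes "x \<in> carrier B4" "y \<in> carrier B4"
  shows "x \<otimes>\<^bsub>B4\<^esub> y \<otimes>\<^bsub>B4\<^esub> inv\<^bsub>B4\<^esub> x \<otimes>\<^bsub>B4\<^esub> inv\<^bsub>B4\<^esub> y \<in> B4'"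
  unfolding braid_commutator_subgroup_def derived_def
  using assms by (intro generate.incl) auto

text \<open>The braid generators are conjugate: \<open>?g\<close> conjugates \<open>sigma1\<close>
  to \<open>sigma2\<close>, and \<open>?k\<close> conjugates \<open>sigma2\<close> to
  \<open>sigma3\<close>. Hence \<open>c4\<close> and \<open>u4 n\<close> are commutators of
  \<open>?k ?g\<close> and of \<open>?P ?g\<close> with \<open>sigma1\<close>.\<close>

lemma c4_u4_in_B4': "c4 \<in> B4'" "u4 n \<in> B4'"
proof -
  let ?g = "sigma1 \<otimes>\<^bsub>B4\<^esub> sigma2"
  let ?k = "sigma2 \<otimes>\<^bsub>B4\<^esub> sigma3"
  let ?P = "sigma1 [^]\<^bsub>B4\<^esub> n"
  have conj: "y = g \<otimes>\<^bsub>B4\<^esub> x \<otimes>\<^bsub>B4\<^esub> inv\<^bsub>B4\<^esub> g"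
    if "g \<otimes>\<^bsub>B4\<^esub> x = y \<otimes>\<^bsub>B4\<^esub> g" "g \<in> carrier B4" "x \<in> carrier B4" "y \<in> carrier B4" for g x y
    using that by (simp add: B4.m_assoc)
  have s2: "sigma2 = ?g \<otimes>\<^bsub>B4\<^esub> sigma1 \<otimes>\<^bsub>B4\<^esub> inv\<^bsub>B4\<^esub> ?g"
    by (rule conj) (use sigma_relations in \<open>simp_all add: B4.m_assoc\<close>)
  have s3: "sigma3 = ?k \<otimes>\<^bsub>B4\<^esub> sigma2 \<otimes>\<^bsub>B4\<^esub> inv\<^bsub>B4\<^esub> ?k"
    by (rule conj) (use sigma_relations in \<open>simp_all add: B4.m_assoc\<close>)
  have "c4 = (?k \<otimes>\<^bsub>B4\<^esub> ?g) \<otimes>\<^bsub>B4\<^esub> sigma1 \<otimes>\<^bsub>B4\<^esub> inv\<^bsub>B4\<^esub> (?k \<otimes>\<^bsub>B4\<^esub> ?g) \<otimes>\<^bsub>B4\<^esub> inv\<^bsub>B4\<^esub> sigma1"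
    unfolding c4_def by (subst s3, subst (2) s2) (simp add: B4.m_assoc B4.inv_mult_group)
  then show "c4 \<in> B4'"
    using commutator_in_B4'[of "?k \<otimes>\<^bsub>B4\<^esub> ?g" sigma1] by simp
  have "u4 n = (?P \<otimes>\<^bsub>B4\<^esub> ?g) \<otimes>\<^bsub>B4\<^esub> sigma1 \<otimes>\<^bsub>B4\<^esub> inv\<^bsub>B4\<^esub> (?P \<otimes>\<^bsub>B4\<^esub> ?g) \<otimes>\<^bsub>B4\<^esub> inv\<^bsub>B4\<^esub> sigma1"
  proof -
    have "?P \<otimes>\<^bsub>B4\<^esub> sigma1 = sigma1 \<otimes>\<^bsub>B4\<^esub> ?P"
      by (simp add: B4.commute_int_pow)
    then have "sigma1 [^]\<^bsub>B4\<^esub> (n + 1) = sigma1 \<otimes>\<^bsub>B4\<^esub> ?P"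
      by (simp add: B4.int_pow_mult)
    then show ?thesis
      unfolding u4_def by (subst s2) (simp add: B4.m_assoc B4.inv_mult_group)
  qed
  then show "u4 n \<in> B4'"
    using commutator_in_B4'[of "?P \<otimes>\<^bsub>B4\<^esub> ?g" sigma1] by simp
qed

lemma subgroup_B4': "subgroup B4' B4"
  unfolding braid_commutator_subgroup_def by (simp add: B4.derived_is_subgroup)

lemma group_G4: "group G4"
  using B4.subgroup_imp_group[OF subgroup_B4'] .

interpretation G4: group G4 by (rule group_G4)

lemma braid_pair_G4: "braid_pair G4 c4 u4"
  using braid_pair_B4 c4_u4_in_B4' by (auto simp: braid_pair_def)

lemma c4_conj: "sigma1 \<otimes>\<^bsub>B4\<^esub> c4 \<otimes>\<^bsub>B4\<^esub> inv\<^bsub>B4\<^esub> sigma1 = c4"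
  "inv\<^bsub>B4\<^esub> sigma1 \<otimes>\<^bsub>B4\<^esub> c4 \<otimes>\<^bsub>B4\<^esub> inv\<^bsub>B4\<^esub> (inv\<^bsub>B4\<^esub> sigma1) = c4"
proof -
  have "sigma3 \<otimes>\<^bsub>B4\<^esub> inv\<^bsub>B4\<^esub> sigma1 = inv\<^bsub>B4\<^esub> sigma1 \<otimes>\<^bsub>B4\<^esub> sigma3"
    by (rule B4.commute_inv) (use sigma_relations in simp_all)
  with sigma_relations(1)[symmetric] show "sigma1 \<otimes>\<^bsub>B4\<^esub> c4 \<otimes>\<^bsub>B4\<^esub> inv\<^bsub>B4\<^esub> sigma1 = c4"
    "inv\<^bsub>B4\<^esub> sigma1 \<otimes>\<^bsub>B4\<^esub> c4 \<otimes>\<^bsub>B4\<^esub> inv\<^bsub>B4\<^esub> (inv\<^bsub>B4\<^esub> sigma1) = c4"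
    unfolding c4_def by (simp_all add: B4.m_assoc B4.cancel_inv)
qed

lemma u4_conj: "sigma1 \<otimes>\<^bsub>B4\<^esub> u4 n \<otimes>\<^bsub>B4\<^esub> inv\<^bsub>B4\<^esub> sigma1 = u4 (n + 1)"
  "inv\<^bsub>B4\<^esub> sigma1 \<otimes>\<^bsub>B4\<^esub> u4 n \<otimes>\<^bsub>B4\<^esub> inv\<^bsub>B4\<^esub> (inv\<^bsub>B4\<^esub> sigma1) = u4 (n - 1)"
proof -
  have *: "sigma1 [^]\<^bsub>B4\<^esub> (k + 1) = sigma1 \<otimes>\<^bsub>B4\<^esub> sigma1 [^]\<^bsub>B4\<^esub> k" for k :: int
    using B4.int_pow_mult[of sigma1 1 k] by (simp add: add.commute)
  show 1: "sigma1 \<otimes>\<^bsub>B4\<^esub> u4 m \<otimes>\<^bsub>B4\<^esub> inv\<^bsub>B4\<^esub> sigma1 = u4 (m + 1)" for m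
    unfolding u4_def * by (simp add: B4.m_assoc B4.inv_mult_group)
  show "inv\<^bsub>B4\<^esub> sigma1 \<otimes>\<^bsub>B4\<^esub> u4 n \<otimes>\<^bsub>B4\<^esub> inv\<^bsub>B4\<^esub> (inv\<^bsub>B4\<^esub> sigma1) = u4 (n - 1)"
    using 1[of "n - 1", symmetric] by (simp add: B4.m_assoc B4.cancel_inv)
qed

text \<open>The subgroup \<open>?H\<close> is normalised by \<open>sigma1\<close>, which fixes
  \<open>c4\<close> and shifts the index of \<open>u4\<close>, and every braid generator lies in
  \<open>?H\<close> times \<open>sigma1\<close>. Induction on words collects the powers of
  \<open>sigma1\<close> on the right.\<close>

lemma B4_eq_generate_times_power:
  assumes "x \<in> carrier B4"
  shows "\<exists>h\<in>generate B4 (insert c4 (range u4)). \<exists>k::int. x = h \<otimes>\<^bsub>B4\<^esub> sigma1 [^]\<^bsub>B4\<^esub> k"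
proof -
  let ?S = "insert c4 (range u4)"
  let ?H = "generate B4 ?S"
  have S: "?S \<subseteq> carrier B4" by auto
  have H: "y \<in> carrier B4" if "y \<in> ?H" for y
    using B4.generate_in_carrier[OF S that] .
  have conj: "sigma1 \<otimes>\<^bsub>B4\<^esub> h \<otimes>\<^bsub>B4\<^esub> inv\<^bsub>B4\<^esub> sigma1 \<in> ?H"
    "inv\<^bsub>B4\<^esub> sigma1 \<otimes>\<^bsub>B4\<^esub> h \<otimes>\<^bsub>B4\<^esub> inv\<^bsub>B4\<^esub> (inv\<^bsub>B4\<^esub> sigma1) \<in> ?H" if "h \<in> ?H" for h
  proof -
    have "x \<in> ?H" if "x \<in> ?S" for x
      using that by (rule generate.incl)
    then have "sigma1 \<otimes>\<^bsub>B4\<^esub> x \<otimes>\<^bsub>B4\<^esub> inv\<^bsub>B4\<^esub> sigma1 \<in> ?H"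
      "inv\<^bsub>B4\<^esub> sigma1 \<otimes>\<^bsub>B4\<^esub> x \<otimes>\<^bsub>B4\<^esub> inv\<^bsub>B4\<^esub> (inv\<^bsub>B4\<^esub> sigma1) \<in> ?H" if "x \<in> ?S" for x
      using that c4_conj u4_conj by auto
    note gen = this
    show "sigma1 \<otimes>\<^bsub>B4\<^esub> h \<otimes>\<^bsub>B4\<^esub> inv\<^bsub>B4\<^esub> sigma1 \<in> ?H"
      by (rule B4.generate_conj_closed[OF S _ gen(1) that]) simp_all
    show "inv\<^bsub>B4\<^esub> sigma1 \<otimes>\<^bsub>B4\<^esub> h \<otimes>\<^bsub>B4\<^esub> inv\<^bsub>B4\<^esub> (inv\<^bsub>B4\<^esub> sigma1) \<in> ?H"
      by (rule B4.generate_conj_closed[OF S _ gen(2) that]) simp_all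
  qed
  \<comment> \<open>\<open>t i\<close> is the \<open>i\<close>-th braid generator times the inverse
    of \<open>sigma1\<close>.\<close>
  define t where "t = (\<lambda>i::nat. if i = 1 then \<one>\<^bsub>B4\<^esub> else if i = 2 then u4 0 else c4)"
  have t: "t i \<in> ?H" for i
    by (auto simp: t_def intro: generate.intros)
  have gen: "generator {1..<4} (braid_relations 4) i = t i \<otimes>\<^bsub>B4\<^esub> sigma1" if "i \<in> {1..<4}" for i
  proof -
    have "i = 1 \<or> i = 2 \<or> i = 3" using that by auto
    moreover have "u4 0 \<otimes>\<^bsub>B4\<^esub> sigma1 = sigma2" "c4 \<otimes>\<^bsub>B4\<^esub> sigma1 = sigma3"
      by (simp_all add: u4_def c4_def B4.m_assoc)
    moreover have "\<one>\<^bsub>B4\<^esub> \<otimes>\<^bsub>B4\<^esub> sigma1 = sigma1"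
      by simp
    ultimately show ?thesis
      by (elim disjE) (simp_all only: t_def sigma1_def sigma2_def sigma3_def, simp_all)
  qed
  have "\<exists>h\<in>?H. \<exists>k::int. word_class {1..<4} (braid_relations 4) w = h \<otimes>\<^bsub>B4\<^esub> sigma1 [^]\<^bsub>B4\<^esub> k"
    if "w \<in> words {1..<4}" for w
    using that
  proof (induction w)
    case Nil
    have "word_class {1..<4} (braid_relations 4) [] = \<one>\<^bsub>B4\<^esub> \<otimes>\<^bsub>B4\<^esub> sigma1 [^]\<^bsub>B4\<^esub> (0 :: int)"
      by (simp add: braid_group_def presented_mult presented_group_def[THEN arg_cong[where f = one]])
    then show ?case using generate.one[of B4 ?S] by blast
  next
    case (Cons l w)
    let ?c = "word_class {1..<4} (braid_relations 4)"
    obtain i b where l: "l = (i, b)" by force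
    have i: "i \<in> {1..<4}" "w \<in> words {1..<4}" using Cons l by auto
    then obtain h and k :: int where h: "h \<in> ?H" and w: "?c w = h \<otimes>\<^bsub>B4\<^esub> sigma1 [^]\<^bsub>B4\<^esub> k"
      using Cons.IH by blast
    have hc [simp]: "h \<in> carrier B4" "t i \<in> carrier B4" using H h t by auto
    have mult: "?c (l # w) = ?c [l] \<otimes>\<^bsub>B4\<^esub> ?c w"
      using presented_mult[of "[l]" "{1..<4}" w "braid_relations 4"] i by (simp add: l braid_group_def)
    have p: "sigma1 [^]\<^bsub>B4\<^esub> (k + 1) = sigma1 \<otimes>\<^bsub>B4\<^esub> sigma1 [^]\<^bsub>B4\<^esub> k"
      "sigma1 [^]\<^bsub>B4\<^esub> (k - 1) = inv\<^bsub>B4\<^esub> sigma1 \<otimes>\<^bsub>B4\<^esub> sigma1 [^]\<^bsub>B4\<^esub> k"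
      using B4.int_pow_mult[of sigma1 1 k] B4.int_pow_mult[of sigma1 "-1" k]
      by (simp_all add: add.commute B4.int_pow_neg)
    show ?case
    proof (cases b)
      case True
      let ?h = "t i \<otimes>\<^bsub>B4\<^esub> (sigma1 \<otimes>\<^bsub>B4\<^esub> h \<otimes>\<^bsub>B4\<^esub> inv\<^bsub>B4\<^esub> sigma1)"
      have "?c [l] = t i \<otimes>\<^bsub>B4\<^esub> sigma1"
        using gen[OF i(1)] by (simp add: l True generator_def)
      then have "?c (l # w) = ?h \<otimes>\<^bsub>B4\<^esub> sigma1 [^]\<^bsub>B4\<^esub> (k + 1)"
        unfolding mult w p by (simp add: B4.m_assoc B4.cancel_inv)
      moreover have "?h \<in> ?H" using t conj(1)[OF h] by (rule generate.eng)
      ultimately show ?thesis by blast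
    next
      case False
      \<comment> \<open>An inverse letter contributes the inverse of \<open>t i\<close> times
        \<open>sigma1\<close>; moving the inverse of \<open>sigma1\<close> past the rest conjugates
        it and lowers the exponent by one.\<close>
      let ?h = "inv\<^bsub>B4\<^esub> sigma1 \<otimes>\<^bsub>B4\<^esub> (inv\<^bsub>B4\<^esub> (t i) \<otimes>\<^bsub>B4\<^esub> h) \<otimes>\<^bsub>B4\<^esub> inv\<^bsub>B4\<^esub> (inv\<^bsub>B4\<^esub> sigma1)"
      have "?c [l] \<otimes>\<^bsub>B4\<^esub> ?c [(i, True)] = \<one>\<^bsub>B4\<^esub>"
        using i(1) word_equiv.cancel[of i "{1..<4}" "braid_relations 4" False]
        by (simp add: l False braid_group_def presented_mult word_class_eq_iff presented_group_def[THEN arg_cong[where f = one]])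
      then have "?c [l] \<otimes>\<^bsub>B4\<^esub> (t i \<otimes>\<^bsub>B4\<^esub> sigma1) = \<one>\<^bsub>B4\<^esub>"
        using gen[OF i(1)] by (simp add: generator_def)
      moreover have "?c [l] \<in> carrier B4"
        using i(1) by (auto simp: l braid_group_def presented_group_def)
      ultimately have "?c [l] = inv\<^bsub>B4\<^esub> (t i \<otimes>\<^bsub>B4\<^esub> sigma1)"
        by (simp add: B4.inv_equality)
      then have "?c (l # w) = ?h \<otimes>\<^bsub>B4\<^esub> sigma1 [^]\<^bsub>B4\<^esub> (k - 1)"
        unfolding mult w p by (simp add: B4.m_assoc B4.inv_mult_group B4.cancel_inv)
      moreover have "?h \<in> ?H"
        by (intro conj(2) generate.eng B4.generate_m_inv_closed[OF S] t h)
      ultimately show ?thesis by blast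
    qed
  qed
  then show ?thesis
    using assms by (auto simp: braid_group_def presented_group_def)
qed

text \<open>The exponent sum \<open>e\<close> vanishes on \<open>B4'\<close> and takes the value 1
  on \<open>sigma1\<close>, so an element of \<open>B4'\<close> written as \<open>h\<close> times
  \<open>sigma1\<close> to the power \<open>k\<close> has \<open>k = 0\<close>.\<close>

lemma B4'_eq_generate: "B4' = generate B4 (insert c4 (range u4))"
proof
  show "generate B4 (insert c4 (range u4)) \<subseteq> B4'"
    using c4_u4_in_B4' by (intro B4.generate_subgroup_incl[OF _ subgroup_B4']) auto
  show "B4' \<subseteq> generate B4 (insert c4 (range u4))" (is "_ \<subseteq> ?H")
  proof
    fix x assume x: "x \<in> B4'"
    obtain e where e: "e \<in> hom B4 integer_group" "e sigma1 = 1"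
      using B4_hom_exists[of integer_group 1 1 1] by (auto simp: group_integer_group)
    interpret e: group_hom B4 integer_group e
      using e by (simp add: group_hom_def group_hom_axioms_def B4.is_group group_integer_group)
    have e0: "e y = 0" if "y \<in> B4'" for y
      using hom_trivial_on_derived[OF B4.is_group abelian_integer_group e(1), of y] that
      by (simp add: braid_commutator_subgroup_def)
    have "x \<in> carrier B4" using x subgroup_B4' by (auto dest: subgroup.mem_carrier)
    then obtain h and k :: int where h: "h \<in> ?H" and xh: "x = h \<otimes>\<^bsub>B4\<^esub> sigma1 [^]\<^bsub>B4\<^esub> k"
      using B4_eq_generate_times_power by blast
    have hB: "h \<in> B4'"
      using h c4_u4_in_B4' B4.generate_subgroup_incl[OF _ subgroup_B4', of "insert c4 (range u4)"] by auto
    have "e (sigma1 [^]\<^bsub>B4\<^esub> k) = k"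
      using e by (simp add: e.hom_int_pow)
    moreover have "h \<in> carrier B4" using hB subgroup_B4' by (auto dest: subgroup.mem_carrier)
    ultimately have "k = 0"
      using e0[OF x] e0[OF hB] xh by simp
    then show "x \<in> ?H" using h xh \<open>h \<in> carrier B4\<close> by simp
  qed
qed

lemma hom_eq_on_B4':
  assumes K: "group K" and h: "h \<in> hom G4 K" and k: "k \<in> hom G4 K"
    and c: "h c4 = k c4" and u: "\<And>n. h (u4 n) = k (u4 n)" and x: "x \<in> B4'"
  shows "h x = k x"
proof -
  interpret h: group_hom G4 K h
    using K h by (simp add: group_hom_def group_hom_axioms_def group_G4)
  interpret k: group_hom G4 K k
    using K k by (simp add: group_hom_def group_hom_axioms_def group_G4)
  have "x \<in> generate B4 (insert c4 (range u4))"
    using x by (simp add: B4'_eq_generate)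
  then show ?thesis
  proof (induction rule: generate.induct)
    case one
    show ?case using h.hom_one k.hom_one by simp
  next
    case (incl y)
    then show ?case using c u by auto
  next
    case (inv y)
    then have y: "y \<in> B4'" "h y = k y" using c u c4_u4_in_B4' by auto
    have "inv\<^bsub>B4\<^esub> y = inv\<^bsub>G4\<^esub> y"
      using B4.m_inv_consistent[OF subgroup_B4' y(1)] by simp
    then show ?case using y h.hom_inv[of y] k.hom_inv[of y] by simp
  next
    case (eng y z)
    then have "y \<in> carrier G4" "z \<in> carrier G4" by (simp_all add: B4'_eq_generate)
    then show ?case using eng h.hom_mult[of y z] k.hom_mult[of y z] by simp
  qed
qed

section \<open>The alternating group on four letters\<close>

text \<open>One-line notation. Equality and composition reduce to four values, so that statements
  about all elements of \<open>A4\<close> can be decided by simplification.\<close>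

definition mk_perm :: "nat \<Rightarrow> nat \<Rightarrow> nat \<Rightarrow> nat \<Rightarrow> nat \<Rightarrow> nat" where
  "mk_perm a b c d = (\<lambda>i. if i = 1 then a else if i = 2 then b else if i = 3 then c else if i = 4 then d else i)"

lemma mk_perm_simps [simp]:
  "mk_perm a b c d (Suc 0) = a" "mk_perm a b c d 2 = b" "mk_perm a b c d 3 = c" "mk_perm a b c d 4 = d"
  by (simp_all add: mk_perm_def)

lemma mk_perm_eq_iff [simp]:
  "mk_perm a b c d = mk_perm a' b' c' d' \<longleftrightarrow> a = a' \<and> b = b' \<and> c = c' \<and> d = d'"
proof
  assume "mk_perm a b c d = mk_perm a' b' c' d'"
  then have "mk_perm a b c d i = mk_perm a' b' c' d' i" for i by simp
  from this[of "Suc 0"] this[of 2] this[of 3] this[of 4]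
  show "a = a' \<and> b = b' \<and> c = c' \<and> d = d'" by simp
qed simp

lemma mk_perm_comp [simp]:
  "mk_perm a b c d \<circ> mk_perm a' b' c' d' =
    mk_perm (mk_perm a b c d a') (mk_perm a b c d b') (mk_perm a b c d c') (mk_perm a b c d d')"
proof
  fix i
  have "mk_perm a b c d i = i" if "i \<noteq> 1" "i \<noteq> 2" "i \<noteq> 3" "i \<noteq> 4"
    using that by (simp add: mk_perm_def)
  then show "(mk_perm a b c d \<circ> mk_perm a' b' c' d') i =
    mk_perm (mk_perm a b c d a') (mk_perm a b c d b') (mk_perm a b c d c') (mk_perm a b c d d') i"
    unfolding mk_perm_def[of a' b' c' d'] mk_perm_def[of "mk_perm a b c d a'"] by simp
qed

lemma mk_perm_id: "id = mk_perm 1 2 3 4"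
  by (auto simp: mk_perm_def fun_eq_iff)

lemma atLeastAtMost_1_4: "{1..4::nat} = {1, 2, 3, 4}"
  by auto

lemma permutes_mk_perm:
  assumes "{a, b, c, d} = {1..4}"
  shows "mk_perm a b c d permutes {1..4}"
proof (rule bij_imp_permutes)
  have "mk_perm a b c d ` {1..4} = {1..4}"
    using assms unfolding atLeastAtMost_1_4 by simp
  then show "bij_betw (mk_perm a b c d) {1..4} {1..4}"
    by (simp add: bij_betw_def eq_card_imp_inj_on)
  show "mk_perm a b c d x = x" if "x \<notin> {1..4}" for x
    using that by (auto simp: mk_perm_def)
qed

definition V4 :: "(nat \<Rightarrow> nat) set" where
  "V4 = {mk_perm 1 2 3 4, mk_perm 2 1 4 3, mk_perm 3 4 1 2, mk_perm 4 3 2 1}"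

text \<open>Grouped by cosets of \<open>V4\<close>; the last eight elements are the
  three-cycles.\<close>

definition A4 :: "(nat \<Rightarrow> nat) set" where
  "A4 = V4 \<union> {mk_perm 2 3 1 4, mk_perm 3 2 4 1, mk_perm 1 4 2 3, mk_perm 4 1 3 2}
    \<union> {mk_perm 3 1 2 4, mk_perm 4 2 1 3, mk_perm 1 3 4 2, mk_perm 2 4 3 1}"

lemma transpose_eq_mk_perm:
  "transpose 1 2 = mk_perm 2 1 3 4" "transpose 1 3 = mk_perm 3 2 1 4" "transpose 1 4 = mk_perm 4 2 3 1"
  "transpose 2 3 = mk_perm 1 3 2 4" "transpose 2 4 = mk_perm 1 4 3 2" "transpose 3 4 = mk_perm 1 2 4 3"
  by (auto simp: mk_perm_def transpose_def fun_eq_iff)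

lemma permutes_insert_factor:
  assumes "p permutes insert a S"
  obtains b q where "b \<in> insert a S" "q permutes S" "p = transpose a b \<circ> q"
proof
  show "p a \<in> insert a S"
    using permutes_in_image[OF assms, of a] by simp
  show "transpose a (p a) \<circ> p permutes S"
    using assms by (rule permutes_insert_lemma)
  show "p = transpose a (p a) \<circ> (transpose a (p a) \<circ> p)"
    by (simp add: comp_assoc[symmetric])
qed

text \<open>Splitting off the images of 1, 2, 3 writes a permutation as a product of three factors,
  each trivial or a transposition. The even products are then listed.\<close>

lemma alt_group_4_subset: "carrier (alt_group 4) \<subseteq> A4"
proof
  fix p assume "p \<in> carrier (alt_group 4)"
  then have p: "p permutes {1, 2, 3, 4}" and even: "evenperm p"
    unfolding alt_group_carrier atLeastAtMost_1_4 by auto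
  obtain b p1 where b: "b \<in> {1, 2, 3, 4}" "p1 permutes {2, 3, 4}" "p = transpose 1 b \<circ> p1"
    using permutes_insert_factor[OF p] by metis
  obtain c p2 where c: "c \<in> {2, 3, 4}" "p2 permutes {3, 4}" "p1 = transpose 2 c \<circ> p2"
    using permutes_insert_factor[OF b(2)] by metis
  obtain d p3 where d: "d \<in> {3, 4}" "p3 permutes {4}" "p2 = transpose 3 d \<circ> p3"
    using permutes_insert_factor[OF c(2)] by metis
  have "p3 = id" using d(2) by simp
  then have p_eq: "p = transpose 1 b \<circ> (transpose 2 c \<circ> transpose 3 d)"
    using b c d by simp
  have "permutation (transpose i j)" for i j :: nat
    by (rule permutation_swap_id)
  \<comment> \<open>Either all three factors are trivial or exactly one is.\<close>
  then have "(1 = b) = ((2 = c) = (3 = d))"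
    using even unfolding p_eq
    by (simp add: evenperm_swap evenperm_comp permutation_compose del: One_nat_def)
  then show "p \<in> A4"
    using b(1) c(1) d(1) unfolding p_eq
    by (elim insertE emptyE)
      (simp_all add: A4_def V4_def transpose_eq_mk_perm mk_perm_id del: One_nat_def, simp_all)
qed

text \<open>The homomorphism from the alternating group onto the integers mod 3 with kernel
  \<open>V4\<close>, residues being written as naturals.\<close>

definition A4_character :: "(nat \<Rightarrow> nat) \<Rightarrow> nat" where
  "A4_character p = (if p \<in> V4 then 0 else
    if p \<in> {mk_perm 2 3 1 4, mk_perm 3 2 4 1, mk_perm 1 4 2 3, mk_perm 4 1 3 2} then 1 else 2)"

lemma A4_character_comp:
  "p \<in> A4 \<Longrightarrow> q \<in> A4 \<Longrightarrow> A4_character (p \<circ> q) = (A4_character p + A4_character q) mod 3"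
proof -
  have "\<forall>p\<in>A4. \<forall>q\<in>A4. A4_character (p \<circ> q) = (A4_character p + A4_character q) mod 3"
    by (simp add: A4_def V4_def A4_character_def)
  then show "p \<in> A4 \<Longrightarrow> q \<in> A4 \<Longrightarrow> A4_character (p \<circ> q) = (A4_character p + A4_character q) mod 3"
    by blast
qed

lemma A4_character_eq_0: "A4_character p = 0 \<longleftrightarrow> p \<in> V4"
  by (simp add: A4_character_def)

lemma A4_character_less: "A4_character p < 3"
  by (simp add: A4_character_def)

lemma V4_comp:
  assumes "p \<in> V4" "q \<in> V4"
  shows "p \<circ> q \<in> V4" "p \<circ> q = q \<circ> p" "p \<circ> p = id"
proof -
  have "\<forall>p\<in>V4. \<forall>q\<in>V4. p \<circ> q \<in> V4 \<and> p \<circ> q = q \<circ> p \<and> p \<circ> p = id"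
    by (simp add: V4_def mk_perm_id)
  then show "p \<circ> q \<in> V4" "p \<circ> q = q \<circ> p" "p \<circ> p = id"
    using assms by blast+
qed

lemma A4_cube:
  assumes "p \<in> A4" "p \<notin> V4"
  shows "p \<circ> p \<circ> p = id"
proof -
  have "\<forall>p\<in>A4. p \<notin> V4 \<longrightarrow> p \<circ> p \<circ> p = id"
    by (simp add: A4_def V4_def mk_perm_id)
  then show ?thesis using assms by blast
qed

text \<open>By enumeration. In \<open>A4_pair_periodic\<close> this places the quotient of
  \<open>A (m + 2)\<close> by \<open>A m\<close> in \<open>V4\<close>.\<close>

lemma A4_centralizer_of_V4:
  assumes "p \<in> A4" "q \<in> V4" "q \<noteq> id" "p \<circ> q = q \<circ> p"
  shows "p \<in> V4"
proof -
  have "\<forall>p\<in>A4. \<forall>q\<in>V4. q \<noteq> id \<longrightarrow> p \<circ> q = q \<circ> p \<longrightarrow> p \<in> V4"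
    by (simp add: A4_def V4_def mk_perm_id)
  then show ?thesis using assms by blast
qed

text \<open>The vectors of coordinate sum zero split into three lines on which \<open>V4\<close>
  acts by its three nontrivial characters. Those fixed by \<open>p\<close> form the line whose
  character is trivial on \<open>p\<close>, and it is -1 on the other nontrivial elements.\<close>

lemma V4_negates_fixed_vector:
  fixes z :: "nat \<Rightarrow> rat"
  assumes "p \<in> V4" "q \<in> V4" "p \<noteq> id" "q \<noteq> id" "p \<noteq> q"
    and "\<And>i. z (p i) = z i" "z 1 + z 2 + z 3 + z 4 = 0" "i \<in> {1..4}"
  shows "z (q i) = - z i"
proof -
  have z: "z (p 1) = z 1" "z (p 2) = z 2" "z (p 3) = z 3" "z (p 4) = z 4"
    using assms(6) by auto
  have "\<forall>p\<in>V4. \<forall>q\<in>V4. p \<noteq> id \<longrightarrow> q \<noteq> id \<longrightarrow> p \<noteq> q \<longrightarrow>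
      z (p 1) = z 1 \<longrightarrow> z (p 2) = z 2 \<longrightarrow> z (p 3) = z 3 \<longrightarrow> z (p 4) = z 4 \<longrightarrow>
      z (q 1) = - z 1 \<and> z (q 2) = - z 2 \<and> z (q 3) = - z 3 \<and> z (q 4) = - z 4"
    using assms(7) by (simp add: V4_def mk_perm_id)
  then have "z (q 1) = - z 1 \<and> z (q 2) = - z 2 \<and> z (q 3) = - z 3 \<and> z (q 4) = - z 4"
    using assms z by blast
  then show ?thesis
    using assms(8) unfolding atLeastAtMost_1_4 by auto
qed

text \<open>There are 3 * 8 = 24 such pairs, permuted simply transitively by conjugation in the
  symmetric group. The standard pair consists of the permutations of \<open>c4\<close> and
  \<open>u4 0\<close>.\<close>

lemma conj_to_standard_pair:
  assumes "p \<in> A4" "p \<notin> V4" "q \<in> V4" "q \<noteq> id"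
  shows "\<exists>r. r permutes {1..4} \<and> r \<circ> mk_perm 2 1 4 3 = q \<circ> r \<and> r \<circ> mk_perm 3 1 2 4 = p \<circ> r"
proof -
  \<comment> \<open>The equations force \<open>r\<close>: its value at 4 is the fixed point
    \<open>x\<close> of \<open>p\<close>, and those at 3, 2, 1 are \<open>q x\<close>,
    \<open>p (q x)\<close>, \<open>p (p (q x))\<close>.\<close>
  have "\<forall>p\<in>A4. \<forall>q\<in>V4. p \<notin> V4 \<longrightarrow> q \<noteq> id \<longrightarrow> (\<exists>x\<in>{1, 2, 3, 4}.
    {p (p (q x)), p (q x), q x, x} = {1, 2, 3, 4} \<and>
    mk_perm (p (p (q x))) (p (q x)) (q x) x \<circ> mk_perm 2 1 4 3 = q \<circ> mk_perm (p (p (q x))) (p (q x)) (q x) x \<and>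
    mk_perm (p (p (q x))) (p (q x)) (q x) x \<circ> mk_perm 3 1 2 4 = p \<circ> mk_perm (p (p (q x))) (p (q x)) (q x) x)"
    by (simp add: A4_def V4_def mk_perm_id) (simp add: set_eq_iff, blast?)
  then obtain x where "{p (p (q x)), p (q x), q x, x} = {1, 2, 3, 4}"
    "mk_perm (p (p (q x))) (p (q x)) (q x) x \<circ> mk_perm 2 1 4 3 = q \<circ> mk_perm (p (p (q x))) (p (q x)) (q x) x"
    "mk_perm (p (p (q x))) (p (q x)) (q x) x \<circ> mk_perm 3 1 2 4 = p \<circ> mk_perm (p (p (q x))) (p (q x)) (q x) x"
    using assms by blast
  then show ?thesis
    using permutes_mk_perm unfolding atLeastAtMost_1_4 by blast
qed

lemma periodic_eq_parity:
  fixes A :: "int \<Rightarrow> 'a"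
  assumes "\<And>n. A (n + 2) = A n"
  shows "A n = A (n mod 2)"
proof -
  have even: "A (m + 2 * int k) = A m" for m k
  proof (induction k)
    case (Suc k)
    then show ?case using assms[of "m + 2 * int k"] by (simp add: algebra_simps)
  qed simp
  show ?thesis
  proof (cases "n \<ge> 0")
    case True
    then have "n = n mod 2 + 2 * int (nat (n div 2))" by simp
    then show ?thesis using even by metis
  next
    case False
    then have "n div 2 \<le> 0" by linarith
    then have "n mod 2 = n + 2 * int (nat (- (n div 2)))"
      by (simp add: minus_div_mult_eq_mod[symmetric])
    then show ?thesis using even by metis
  qed
qed

lemma A4_comp:
  assumes "p \<in> A4" "q \<in> A4"
  shows "p \<circ> q \<in> A4"
proof -
  have "\<forall>p\<in>A4. \<forall>q\<in>A4. p \<circ> q \<in> A4"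
    by (simp add: A4_def V4_def)
  then show ?thesis using assms by blast
qed

lemma A4_inverse:
  assumes "p \<in> A4"
  obtains q where "q \<in> A4" "q \<circ> p = id" "p \<circ> q = id"
proof (cases "p \<in> V4")
  case True
  then show ?thesis using that[of p] assms V4_comp(3)[OF True True] by simp
next
  case False
  then show ?thesis
    using that[of "p \<circ> p"] A4_cube[OF assms False] A4_comp[OF assms assms] by (simp add: comp_assoc)
qed

section \<open>Images of a braid pair in the alternating group: \<open>C\<close>, \<open>A\<close>,
  \<open>W\<close> stand for the images of \<open>c\<close>, \<open>u\<close> and
  \<open>conj_seq\<close>\<close>

context
  fixes C :: "nat \<Rightarrow> nat" and A W :: "int \<Rightarrow> nat \<Rightarrow> nat"
  assumes C: "C \<in> A4" "C \<noteq> id" and A: "\<And>n. A n \<in> A4"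
    and conj: "\<And>n. A n \<circ> W n = C \<circ> A n" and step: "\<And>n. W (n + 1) = W n \<circ> C"
begin

lemma A4_pair_conj_mem: "W n \<in> A4"
proof -
  obtain q where q: "q \<in> A4" "q \<circ> A n = id"
    using A4_inverse[OF A] by metis
  have "W n = q \<circ> (A n \<circ> W n)"
    using q(2) by (simp add: comp_assoc[symmetric])
  then show ?thesis
    using q(1) C(1) A by (simp add: conj A4_comp)
qed

text \<open>Modulo \<open>V4\<close> conjugate elements agree, so \<open>W n\<close> and
  \<open>C\<close> have the same character; the step relation then says that this character equals
  its double.\<close>

lemma A4_pair_V4: "C \<in> V4" "W n \<in> V4"
proof -
  have lt3: "a = 0 \<or> a = 1 \<or> a = 2" if "a < 3" for a :: nat
    using that by arith
  have *: "A4_character (W m) = A4_character C" for m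
  proof -
    have "(A4_character (A m) + A4_character (W m)) mod 3 = (A4_character C + A4_character (A m)) mod 3"
      using arg_cong[OF conj[of m], of A4_character] C A A4_pair_conj_mem by (simp add: A4_character_comp)
    moreover have "w = c" if "(a + w) mod 3 = (c + a) mod 3" "a < 3" "w < 3" "c < 3" for a w c :: nat
      using lt3[OF that(2)] lt3[OF that(3)] lt3[OF that(4)] that(1) by (elim disjE) simp_all
    ultimately show ?thesis
      using A4_character_less by blast
  qed
  have "A4_character C = (A4_character C + A4_character C) mod 3"
    using arg_cong[OF step[of 0], of A4_character] C A4_pair_conj_mem *[of 0] *[of 1]
    by (simp add: A4_character_comp)
  moreover have "c = 0" if "c = (c + c) mod 3" "c < 3" for c :: nat
    using lt3[OF that(2)] that(1) by (elim disjE) simp_all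
  ultimately have "A4_character C = 0"
    using A4_character_less by blast
  then show "C \<in> V4" "W n \<in> V4"
    using * by (simp_all add: A4_character_eq_0[symmetric])
qed

text \<open>\<open>W n\<close> is conjugate to \<open>C\<close>. If it were equal to
  \<open>C\<close>, the next conjugate would be the square of \<open>C\<close>, which is
  trivial.\<close>

lemma A4_pair_conj_ne: "W n \<noteq> id" "W n \<noteq> C"
proof -
  show 1: "W m \<noteq> id" for m
  proof
    assume "W m = id"
    then have "A m = C \<circ> A m" using conj[of m] by simp
    then show False
      using C(2) A4_inverse[OF A, of m] by (metis comp_assoc comp_id id_comp)
  qed
  show "W n \<noteq> C"
    using step[of n] 1[of "n + 1"] V4_comp(3)[OF A4_pair_V4(1) A4_pair_V4(1)] by auto
qed

text \<open>\<open>V4\<close> is abelian, so an element of it would conjugate \<open>C\<close> to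
  \<open>C\<close> itself.\<close>

lemma A4_pair_not_V4: "A n \<notin> V4"
proof
  assume "A n \<in> V4"
  then have "A n \<circ> W n = A n \<circ> C"
    using V4_comp(2) A4_pair_V4(1) conj by metis
  then show False
    using A4_pair_conj_ne(2)[of n] A4_inverse[OF A, of n] by (metis comp_assoc id_comp)
qed

lemma A4_pair_conj_shift: "W (n + 2) = W n"
  using step[of n] step[of "n + 1"] V4_comp(3)[OF A4_pair_V4(1) A4_pair_V4(1)]
  by (simp add: comp_assoc add.commute)

text \<open>The quotient \<open>D\<close> of \<open>A (m + 2)\<close> by \<open>A m\<close> lies in
  \<open>V4\<close> and fixes \<open>z\<close>, which leaves only \<open>id\<close> and
  \<open>C\<close>; the recurrence for \<open>A\<close> rules out \<open>C\<close>.\<close>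

lemma A4_pair_periodic:
  fixes z :: "nat \<Rightarrow> rat"
  assumes rel: "\<And>n. A (n + 1) = A n \<circ> A (n + 2)"
    and z: "z \<circ> C = z" "z 1 + z 2 + z 3 + z 4 = 0" "i \<in> {1..4}" "z i \<noteq> 0"
    and zA: "\<And>n. z \<circ> A (n + 2) = z \<circ> A n"
  shows "A (n + 2) = A n"
proof -
  have cases: "A (m + 2) = A m \<or> A (m + 2) = C \<circ> A m" for m
  proof -
    obtain q where q: "q \<in> A4" "q \<circ> A m = id" "A m \<circ> q = id"
      using A4_inverse[OF A] by metis
    define D where "D = A (m + 2) \<circ> q"
    have AD: "A (m + 2) = D \<circ> A m"
      using q(2) by (simp add: D_def comp_assoc)
    have "D \<in> A4" using q A by (simp add: D_def A4_comp)
    \<comment> \<open>\<open>A m\<close> and \<open>A (m + 2)\<close> conjugate the same element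
      \<open>W m = W (m + 2)\<close> to \<open>C\<close>, so \<open>D\<close> commutes with
      \<open>C\<close>.\<close>
    have "q \<circ> C = q \<circ> (C \<circ> A m) \<circ> q"
      using q(3) by (simp add: comp_assoc)
    also have "\<dots> = W m \<circ> q"
      using q(2) by (simp add: conj[symmetric] comp_assoc[symmetric])
    finally have "D \<circ> C = A (m + 2) \<circ> W (m + 2) \<circ> q"
      by (simp add: D_def comp_assoc A4_pair_conj_shift)
    also have "\<dots> = C \<circ> D"
      by (simp add: conj D_def comp_assoc)
    finally have "D \<in> V4"
      using A4_centralizer_of_V4 \<open>D \<in> A4\<close> A4_pair_V4(1) C(2) by blast
    have zD: "z \<circ> D = z"
      using zA[of m] q(3) by (simp add: D_def comp_assoc[symmetric]) (simp add: comp_assoc)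
    have "D = id \<or> D = C"
    proof (rule ccontr)
      assume "\<not> (D = id \<or> D = C)"
      then have "z (D i) = - z i"
        using V4_negates_fixed_vector[OF A4_pair_V4(1) \<open>D \<in> V4\<close> C(2), of z i] z by (metis comp_apply)
      moreover have "z (D i) = z i"
        using fun_cong[OF zD, of i] by simp
      ultimately show False
        using z(4) by simp
    qed
    then show ?thesis using AD by auto
  qed
  show ?thesis
  proof (rule ccontr)
    assume "A (n + 2) \<noteq> A n"
    with cases[of n] have 2: "A (n + 2) = C \<circ> A n" by blast
    then have 1: "A (n + 1) = A n \<circ> (C \<circ> A n)" using rel[of n] by simp
    obtain E where E: "E = id \<or> E = C" "A (n + 3) = E \<circ> A (n + 1)"
    proof -
      have "A (n + 3) = A (n + 1) \<or> A (n + 3) = C \<circ> A (n + 1)"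
        using cases[of "n + 1"] by (simp add: add.assoc)
      then show thesis using that[of id] that[of C] by auto
    qed
    \<comment> \<open>Substitute into the recurrence at \<open>n + 1\<close>. With
      \<open>C \<circ> ?a = ?a \<circ> W n\<close>, the cube of \<open>?a\<close> and the square of
      \<open>W n\<close> being trivial, the equation collapses to
      \<open>W n \<circ> E = id\<close>.\<close>
    let ?a = "A n"
    obtain q where q: "q \<circ> ?a = id" using A4_inverse[OF A] by metis
    have cube: "?a \<circ> (?a \<circ> ?a) = id"
      using A4_cube[OF A A4_pair_not_V4, of n] by (simp add: comp_assoc)
    have "A (n + 1) \<circ> A (n + 3) = C \<circ> ?a"
      using rel[of "n + 1"] 2 by (simp add: add.commute)
    then have "?a \<circ> (C \<circ> ?a \<circ> E \<circ> ?a \<circ> (C \<circ> ?a)) = C \<circ> ?a"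
      by (simp add: 1 E(2) comp_assoc)
    then have "?a \<circ> (?a \<circ> W n \<circ> E \<circ> ?a \<circ> (?a \<circ> W n)) = ?a \<circ> W n"
      by (simp only: conj)
    then have "q \<circ> (?a \<circ> (?a \<circ> W n \<circ> E \<circ> ?a \<circ> (?a \<circ> W n))) = q \<circ> (?a \<circ> W n)"
      by (simp only:)
    then have "?a \<circ> W n \<circ> E \<circ> ?a \<circ> (?a \<circ> W n) = W n"
      unfolding comp_assoc[of q, symmetric] q by simp
    then have "?a \<circ> W n \<circ> E \<circ> ?a \<circ> (?a \<circ> W n) \<circ> W n = W n \<circ> W n"
      by (simp only:)
    moreover have WW: "W n \<circ> W n = id"
      using V4_comp(3) A4_pair_V4(2) by blast
    ultimately have "?a \<circ> (W n \<circ> E \<circ> (?a \<circ> ?a)) = id"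
      by (simp add: comp_assoc)
    then have "?a \<circ> ?a \<circ> (?a \<circ> (W n \<circ> E \<circ> (?a \<circ> ?a))) \<circ> ?a = ?a \<circ> ?a \<circ> id \<circ> ?a"
      by (simp only:)
    then have "(?a \<circ> (?a \<circ> ?a)) \<circ> (W n \<circ> E) \<circ> (?a \<circ> (?a \<circ> ?a)) = ?a \<circ> (?a \<circ> ?a)"
      by (simp only: comp_assoc id_comp)
    then have "W n \<circ> E = id"
      unfolding cube by simp
    then have "W n \<circ> (W n \<circ> E) = W n" by simp
    then have "E = W n"
      using WW by (simp add: comp_assoc[symmetric])
    then show False
      using E(1) A4_pair_conj_ne by blast
  qed
qed

end

section \<open>A double cover of the symmetric group\<close>

lemma F3_cases: "x = 0 \<or> x = 1 \<or> x = (- 1 :: 3)"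
proof -
  have "{0, 1, - 1 :: 3} = UNIV"
    by (rule card_seteq) (simp_all add: eq_neg_iff_add_eq_0)
  then show ?thesis by blast
qed

text \<open>Over a prime field additive maps are linear.\<close>

definition F3_additive :: "(3 \<times> 3 \<Rightarrow> 3 \<times> 3) \<Rightarrow> bool" where
  "F3_additive t \<longleftrightarrow> (\<forall>x y. t (x + y) = t x + t y)"

text \<open>Spanning vectors of the four lines, numbered 1 to 4.\<close>

definition line_point :: "nat \<Rightarrow> 3 \<times> 3" where
  "line_point i = (if i = 1 then (1, 0) else if i = 2 then (0, 1) else if i = 3 then (1, 1) else (1, - 1))"

lemma line_point_simps [simp]:
  "line_point (Suc 0) = (1, 0)" "line_point 2 = (0, 1)" "line_point 3 = (1, 1)" "line_point 4 = (1, - 1)"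
  by (simp_all add: line_point_def)

text \<open>\<open>GL(2,3)\<close> together with its action on the four lines of the plane over the field with three
  elements; the second component is determined by the first, up to sign also conversely.\<close>

definition line_cover :: "((3 \<times> 3 \<Rightarrow> 3 \<times> 3) \<times> (nat \<Rightarrow> nat)) monoid" where
  "line_cover =
    \<lparr>carrier = {(t, p). bij t \<and> F3_additive t \<and> p permutes {1..4} \<and>
       (\<forall>i\<in>{1..4}. t (line_point i) = line_point (p i) \<or> t (line_point i) = - line_point (p i))},
     mult = (\<lambda>(t, p) (t', p'). (t \<circ> t', p \<circ> p')),
     one = (id, id)\<rparr>"

lemma F3_additiveD: "F3_additive t \<Longrightarrow> t (x + y) = t x + t y"
  unfolding F3_additive_def by blast

lemma F3_additive_minus:
  assumes "F3_additive t"
  shows "t 0 = 0" "t (- x) = - t x"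
proof -
  show 0: "t 0 = 0" using F3_additiveD[OF assms, of 0 0] by simp
  show "t (- x) = - t x"
    using F3_additiveD[OF assms, of "- x" x] 0 by (simp add: eq_neg_iff_add_eq_0)
qed

lemma F3_additive_comp: "F3_additive t \<Longrightarrow> F3_additive t' \<Longrightarrow> F3_additive (t \<circ> t')"
  unfolding F3_additive_def by (simp only: o_apply) simp

lemma group_line_cover: "group line_cover"
proof (rule groupI)
  fix x y assume "x \<in> carrier line_cover" "y \<in> carrier line_cover"
  then obtain t p t' p' where xy: "x = (t, p)" "y = (t', p')"
    and t: "bij t" "F3_additive t" "p permutes {1..4}"
      "\<And>i. i \<in> {1..4} \<Longrightarrow> t (line_point i) = line_point (p i) \<or> t (line_point i) = - line_point (p i)"
    and t': "bij t'" "F3_additive t'" "p' permutes {1..4}"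
      "\<And>i. i \<in> {1..4} \<Longrightarrow> t' (line_point i) = line_point (p' i) \<or> t' (line_point i) = - line_point (p' i)"
    by (auto simp: line_cover_def)
  have "t (t' (line_point i)) = line_point (p (p' i)) \<or> t (t' (line_point i)) = - line_point (p (p' i))"
    if i: "i \<in> {1..4}" for i
  proof -
    have "p' i \<in> {1..4}" using i permutes_in_image[OF t'(3)] by blast
    from t(4)[OF this] t'(4)[OF i] show ?thesis
      by (auto simp: F3_additive_minus(2)[OF t(2)])
  qed
  then show "x \<otimes>\<^bsub>line_cover\<^esub> y \<in> carrier line_cover"
    using t t' by (simp add: xy line_cover_def bij_comp permutes_compose F3_additive_comp)
next
  show "\<one>\<^bsub>line_cover\<^esub> \<in> carrier line_cover"
    by (simp add: line_cover_def permutes_id F3_additive_def)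
next
  show "x \<otimes>\<^bsub>line_cover\<^esub> y \<otimes>\<^bsub>line_cover\<^esub> z = x \<otimes>\<^bsub>line_cover\<^esub> (y \<otimes>\<^bsub>line_cover\<^esub> z)" for x y z
    by (auto simp: line_cover_def split: prod.splits)
next
  show "\<one>\<^bsub>line_cover\<^esub> \<otimes>\<^bsub>line_cover\<^esub> x = x" for x
    by (auto simp: line_cover_def split: prod.splits)
next
  fix x assume "x \<in> carrier line_cover"
  then obtain t p where x: "x = (t, p)"
    and t: "bij t" "F3_additive t" "p permutes {1..4}"
      "\<And>i. i \<in> {1..4} \<Longrightarrow> t (line_point i) = line_point (p i) \<or> t (line_point i) = - line_point (p i)"
    by (auto simp: line_cover_def)
  have inv_t: "inv' t (t v) = v" "t (inv' t v) = v" for v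
    using t(1) by (simp_all add: bij_is_inj bij_is_surj surj_f_inv_f)
  have add: "F3_additive (inv' t)"
    unfolding F3_additive_def
    using F3_additiveD[OF t(2), of "inv' t _" "inv' t _"] inv_t by metis
  have "inv' t (line_point i) = line_point (inv' p i) \<or> inv' t (line_point i) = - line_point (inv' p i)"
    if i: "i \<in> {1..4}" for i
  proof -
    have "inv' p i \<in> {1..4}" "p (inv' p i) = i"
      using i permutes_in_image[OF permutes_inv[OF t(3)]] permutes_inverses(1)[OF t(3)] by auto
    with t(4)[of "inv' p i"] have "t (line_point (inv' p i)) = line_point i \<or>
        t (line_point (inv' p i)) = - line_point i" by simp
    then show ?thesis
      using inv_t(1)[of "line_point (inv' p i)"] F3_additive_minus(2)[OF add]
      by (metis minus_minus)
  qed
  then have "(inv' t, inv' p) \<in> carrier line_cover"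
    using t add by (simp add: line_cover_def bij_imp_bij_inv permutes_inv)
  moreover have "(inv' t, inv' p) \<otimes>\<^bsub>line_cover\<^esub> x = \<one>\<^bsub>line_cover\<^esub>"
    using permutes_inv_o(2)[OF t(3)] inv_t(1) by (auto simp: x line_cover_def fun_eq_iff)
  ultimately show "\<exists>y\<in>carrier line_cover. y \<otimes>\<^bsub>line_cover\<^esub> x = \<one>\<^bsub>line_cover\<^esub>" by blast
qed

lemma line_cover_hom: "snd \<in> hom line_cover (sym_group 4)"
  by (auto simp: hom_def line_cover_def sym_group_def)

lemma line_cover_linear:
  assumes "\<And>x y. t (t' (x, y)) = (x, y)" "\<And>x y. t' (t (x, y)) = (x, y)"
    and "\<And>x y x' y'. t (x + x', y + y') = t (x, y) + t (x', y')" and "{a, b, c, d} = {1, 2, 3, 4}"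
    and "t (1, 0) = line_point a \<or> t (1, 0) = - line_point a"
    and "t (0, 1) = line_point b \<or> t (0, 1) = - line_point b"
    and "t (1, 1) = line_point c \<or> t (1, 1) = - line_point c"
    and "t (1, - 1) = line_point d \<or> t (1, - 1) = - line_point d"
  shows "(t, mk_perm a b c d) \<in> carrier line_cover"
proof -
  have "bij t"
    by (rule o_bij[of t']) (use assms in \<open>auto simp: fun_eq_iff\<close>)
  moreover have "F3_additive t"
    unfolding F3_additive_def using assms(3) by (simp add: split_paired_all)
  moreover have "mk_perm a b c d permutes {1..4}"
    using assms(4) by (intro permutes_mk_perm) (simp only: atLeastAtMost_1_4)
  moreover have "\<forall>i\<in>{1, 2, 3, 4}. t (line_point i) = line_point (mk_perm a b c d i) \<or>
      t (line_point i) = - line_point (mk_perm a b c d i)"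
    using assms(5-8) by simp
  ultimately show ?thesis
    unfolding line_cover_def atLeastAtMost_1_4[symmetric] by simp
qed

text \<open>The lifts are explicit reflections, each its own inverse, which preserve two of the
  lines and exchange the other two. The case \<open>a = b\<close> covers trivial factors in
  \<open>line_cover_surj\<close>.\<close>

lemma line_cover_transpose:
  assumes "a \<in> {1..4}" "b \<in> {1..4}" "a \<le> b"
  shows "\<exists>t. (t, transpose a b) \<in> carrier line_cover"
proof -
  have two: "(1::3) + 1 = - 1" "(- 1::3) - 1 = 1"
    by (simp_all add: eq_neg_iff_add_eq_0)
  have "a = b \<or> (a = 1 \<and> b = 2) \<or> (a = 1 \<and> b = 3) \<or> (a = 1 \<and> b = 4) \<or> (a = 2 \<and> b = 3) \<or>
    (a = 2 \<and> b = 4) \<or> (a = 3 \<and> b = 4)"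
    using assms by auto
  moreover have "(id, transpose a a) \<in> carrier line_cover" for a
    using monoid.one_closed[OF group.is_monoid[OF group_line_cover]] by (simp add: line_cover_def)
  moreover have "(\<lambda>(x, y). (y, x), transpose 1 2) \<in> carrier line_cover"
    unfolding transpose_eq_mk_perm
    by (rule line_cover_linear[where t' = "\<lambda>(x, y). (y, x)"]) (auto simp: line_point_def two)
  moreover have "(\<lambda>(x, y). (x, x - y), transpose 1 3) \<in> carrier line_cover"
    unfolding transpose_eq_mk_perm
    by (rule line_cover_linear[where t' = "\<lambda>(x, y). (x, x - y)"]) (auto simp: line_point_def two)
  moreover have "(\<lambda>(x, y). (x, - x - y), transpose 1 4) \<in> carrier line_cover"
    unfolding transpose_eq_mk_perm
    by (rule line_cover_linear[where t' = "\<lambda>(x, y). (x, - x - y)"]) (auto simp: line_point_def two)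
  moreover have "(\<lambda>(x, y). (y - x, y), transpose 2 3) \<in> carrier line_cover"
    unfolding transpose_eq_mk_perm
    by (rule line_cover_linear[where t' = "\<lambda>(x, y). (y - x, y)"]) (auto simp: line_point_def two)
  moreover have "(\<lambda>(x, y). (x + y, - y), transpose 2 4) \<in> carrier line_cover"
    unfolding transpose_eq_mk_perm
    by (rule line_cover_linear[where t' = "\<lambda>(x, y). (x + y, - y)"]) (auto simp: line_point_def two)
  moreover have "(\<lambda>(x, y). (x, - y), transpose 3 4) \<in> carrier line_cover"
    unfolding transpose_eq_mk_perm
    by (rule line_cover_linear[where t' = "\<lambda>(x, y). (x, - y)"]) (auto simp: line_point_def two)
  ultimately show ?thesis
    by (elim disjE conjE) (hypsubst, blast)+
qed

lemma line_cover_surj: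
  assumes p: "p permutes {1..4}"
  shows "\<exists>t. (t, p) \<in> carrier line_cover"
proof -
  have comp: "\<exists>t. (t, p \<circ> q) \<in> carrier line_cover"
    if "\<exists>t. (t, p) \<in> carrier line_cover" "\<exists>t. (t, q) \<in> carrier line_cover" for p q
  proof -
    from that obtain t t' where "(t, p) \<in> carrier line_cover" "(t', q) \<in> carrier line_cover" by blast
    then have "(t, p) \<otimes>\<^bsub>line_cover\<^esub> (t', q) \<in> carrier line_cover"
      using group.is_monoid[OF group_line_cover] by (rule monoid.m_closed[rotated])
    moreover have "(t, p) \<otimes>\<^bsub>line_cover\<^esub> (t', q) = (t \<circ> t', p \<circ> q)"
      by (simp add: line_cover_def)
    ultimately show ?thesis by auto
  qed
  from p have p': "p permutes {1, 2, 3, 4}"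
    unfolding atLeastAtMost_1_4 .
  obtain b p1 where b: "b \<in> {1, 2, 3, 4}" "p1 permutes {2, 3, 4}" "p = transpose 1 b \<circ> p1"
    using permutes_insert_factor[OF p'] by metis
  obtain c p2 where c: "c \<in> {2, 3, 4}" "p2 permutes {3, 4}" "p1 = transpose 2 c \<circ> p2"
    using permutes_insert_factor[OF b(2)] by metis
  obtain d p3 where d: "d \<in> {3, 4}" "p3 permutes {4}" "p2 = transpose 3 d \<circ> p3"
    using permutes_insert_factor[OF c(2)] by metis
  have "p = transpose 1 b \<circ> (transpose 2 c \<circ> transpose 3 d)"
    using b c d by simp
  moreover have "\<exists>t. (t, transpose 1 b) \<in> carrier line_cover" "\<exists>t. (t, transpose 2 c) \<in> carrier line_cover"
    "\<exists>t. (t, transpose 3 d) \<in> carrier line_cover"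
    using b(1) c(1) d(1) by (intro line_cover_transpose; auto)+
  ultimately show ?thesis
    using comp by metis
qed

section \<open>The kernel of the double cover and its obstruction to lifting\<close>

lemma F3_additive_eq_on_basis:
  assumes t: "F3_additive t" and t': "F3_additive t'"
    and eq: "t (1, 0) = t' (1, 0)" "t (0, 1) = t' (0, 1)"
  shows "t = t'"
proof
  fix v :: "3 \<times> 3"
  obtain x y where v: "v = (x, y)" by force
  have "t (x, 0) = t' (x, 0)"
    using F3_cases[of x] eq(1) F3_additive_minus[OF t] F3_additive_minus[OF t']
      F3_additive_minus(2)[OF t, of "(1, 0)"] F3_additive_minus(2)[OF t', of "(1, 0)"]
    by (elim disjE) (simp_all add: zero_prod_def)
  moreover have "t (0, y) = t' (0, y)"
    using F3_cases[of y] eq(2) F3_additive_minus[OF t] F3_additive_minus[OF t']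
      F3_additive_minus(2)[OF t, of "(0, 1)"] F3_additive_minus(2)[OF t', of "(0, 1)"]
    by (elim disjE) (simp_all add: zero_prod_def)
  ultimately show "t v = t' v"
    using F3_additiveD[OF t, of "(x, 0)" "(0, y)"] F3_additiveD[OF t', of "(x, 0)" "(0, y)"] by (simp add: v)
qed

text \<open>Each basis vector goes to itself or its negative, and the signs agree because the line
  of their sum is preserved as well.\<close>

lemma line_cover_kernel:
  assumes "(t, id) \<in> carrier line_cover"
  shows "t = id \<or> t = uminus"
proof -
  have add: "F3_additive t"
    and l: "\<And>i. i \<in> {1..4} \<Longrightarrow> t (line_point i) = line_point i \<or> t (line_point i) = - line_point i"
    using assms by (auto simp: line_cover_def)
  have "t (1, 0) = (1, 0) \<or> t (1, 0) = (- 1, 0)" "t (0, 1) = (0, 1) \<or> t (0, 1) = (0, - 1)"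
    "t (1, 1) = (1, 1) \<or> t (1, 1) = (- 1, - 1)"
    using l[of 1] l[of 2] l[of 3] by (simp_all add: line_point_def)
  moreover have "t (1, 1) = t (1, 0) + t (0, 1)"
    using F3_additiveD[OF add, of "(1, 0)" "(0, 1)"] by simp
  ultimately have "t (1, 0) = (1, 0) \<and> t (0, 1) = (0, 1) \<or> t (1, 0) = - (1, 0) \<and> t (0, 1) = - (0, 1)"
    by auto
  then show ?thesis
    using F3_additive_eq_on_basis[OF add, of id] F3_additive_eq_on_basis[OF add, of uminus]
    by (auto simp: F3_additive_def)
qed

text \<open>The map exchanges the lines of the two basis vectors up to signs. As it takes their sum
  to a multiple of their difference, the signs are opposite and the square is -1.\<close>

lemma line_cover_double_transposition:
  assumes "(t, mk_perm 2 1 4 3) \<in> carrier line_cover"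
  shows "t \<circ> t \<noteq> id"
proof
  assume tt: "t \<circ> t = id"
  have add: "F3_additive t"
    and l: "\<And>i. i \<in> {1..4} \<Longrightarrow> t (line_point i) = line_point (mk_perm 2 1 4 3 i) \<or>
      t (line_point i) = - line_point (mk_perm 2 1 4 3 i)"
    using assms by (auto simp: line_cover_def)
  have 1: "t (1, 0) = (0, 1) \<or> t (1, 0) = (0, - 1)" and 2: "t (0, 1) = (1, 0) \<or> t (0, 1) = (- 1, 0)"
    and 3: "t (1, 1) = (1, - 1) \<or> t (1, 1) = (- 1, 1)"
    using l[of 1] l[of 2] l[of 3] by (simp_all add: line_point_def)
  have 4: "t (1, 1) = t (1, 0) + t (0, 1)"
    using F3_additiveD[OF add, of "(1, 0)" "(0, 1)"] by simp
  have "t (t (1, 0)) = (1, 0)"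
    using tt by (simp add: fun_eq_iff)
  then show False
    using 1 2 3 4 F3_additive_minus(2)[OF add, of "(0, 1)"] by auto
qed

text \<open>The elements \<open>u\<^sub>1\<close> and \<open>u\<^sub>3\<close> differ by a central element, so they conjugate \<open>c\<close> to the same
  element; but these conjugates differ by \<open>c\<^sup>2\<close>, which is not trivial.\<close>

lemma line_cover_obstruction:
  assumes cu: "braid_pair line_cover c u"
    and snd: "snd c = mk_perm 2 1 4 3" "snd (u 3) = snd (u 1)"
  shows False
proof -
  interpret group line_cover by (rule group_line_cover)
  note [simp] = braid_pair_closed[OF cu] conj_seq_closed[OF cu]
  let ?w = "conj_seq c u"
  have z: "inv\<^bsub>line_cover\<^esub> u 1 \<otimes>\<^bsub>line_cover\<^esub> u 3 \<in> carrier line_cover" by simp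
  have "snd (inv\<^bsub>line_cover\<^esub> u 1 \<otimes>\<^bsub>line_cover\<^esub> u 3) = id"
  proof -
    interpret group_hom line_cover "sym_group 4" snd
      using line_cover_hom by (simp add: group_hom_def group_hom_axioms_def sym_group_is_group)
    have "snd (u 1) \<in> carrier (sym_group 4)"
      using hom_closed by simp
    then show ?thesis
      using snd(2) permutes_inv_o(2) by (simp add: sym_group_mult sym_group_carrier)
  qed
  then obtain s where s: "inv\<^bsub>line_cover\<^esub> u 1 \<otimes>\<^bsub>line_cover\<^esub> u 3 = (s, id)" "s = id \<or> s = uminus"
    using line_cover_kernel z by (metis prod.collapse)
  have central: "(s, id) \<otimes>\<^bsub>line_cover\<^esub> x = x \<otimes>\<^bsub>line_cover\<^esub> (s, id)" if "x \<in> carrier line_cover" for x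
  proof -
    obtain t p where x: "x = (t, p)" by force
    have "t \<circ> uminus = uminus \<circ> t"
    proof
      have "F3_additive t"
        using that by (simp add: x line_cover_def)
      then show "(t \<circ> uminus) v = (uminus \<circ> t) v" for v
        by (simp only: o_apply F3_additive_minus(2))
    qed
    then have "s \<circ> t = t \<circ> s"
      using s(2) by (elim disjE) simp_all
    then show ?thesis
      by (simp add: x line_cover_def)
  qed
  have u3: "u 3 = u 1 \<otimes>\<^bsub>line_cover\<^esub> (s, id)" and sc [simp]: "(s, id) \<in> carrier line_cover"
    using s(1) z by (metis cancel_inv(2) braid_pair_closed(2)[OF cu], simp)
  have "?w 3 = inv\<^bsub>line_cover\<^esub> (s, id) \<otimes>\<^bsub>line_cover\<^esub> (?w 1 \<otimes>\<^bsub>line_cover\<^esub> (s, id))"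
    by (simp add: conj_seq_def u3 inv_mult_group m_assoc)
  also have "\<dots> = ?w 1"
    using central[of "?w 1"] by (simp add: central[symmetric] cancel_inv)
  finally have "c \<otimes>\<^bsub>line_cover\<^esub> c = \<one>\<^bsub>line_cover\<^esub>"
    using conj_seq_shift[OF cu, of 0] by simp
  moreover obtain t where "c = (t, mk_perm 2 1 4 3)"
    using snd(1) by (cases c) auto
  ultimately show False
    using line_cover_double_transposition[of t] braid_pair_closed(1)[OF cu]
    by (auto simp: line_cover_def)
qed

section \<open>Affine transformations\<close>

text \<open>The pair \<open>(p, v)\<close> stands for the map \<open>x \<mapsto> x \<circ> p + v\<close>, and these maps are composed from left to
  right.\<close>

definition affine_S4 :: "((nat \<Rightarrow> nat) \<times> (nat \<Rightarrow> rat)) monoid" where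
  "affine_S4 =
    \<lparr>carrier = {(p, v). p permutes {1..4} \<and> (\<forall>i. i \<notin> {1..4} \<longrightarrow> v i = 0)},
     mult = (\<lambda>(p, v) (q, w). (p \<circ> q, (\<lambda>i. v (q i) + w i))),
     one = (id, (\<lambda>_. 0))\<rparr>"

lemma group_affine_S4: "group affine_S4"
proof (rule groupI)
  fix x y assume "x \<in> carrier affine_S4" "y \<in> carrier affine_S4"
  then obtain p v q w where xy: "x = (p, v)" "y = (q, w)" "p permutes {1..4}" "q permutes {1..4}"
    "\<And>i. i \<notin> {1..4} \<Longrightarrow> v i = 0" "\<And>i. i \<notin> {1..4} \<Longrightarrow> w i = 0"
    by (auto simp: affine_S4_def)
  moreover have "v (q i) + w i = 0" if "i \<notin> {1..4}" for i
    using xy that permutes_not_in[OF xy(4) that] by simp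
  ultimately show "x \<otimes>\<^bsub>affine_S4\<^esub> y \<in> carrier affine_S4"
    by (simp add: affine_S4_def permutes_compose)
next
  show "\<one>\<^bsub>affine_S4\<^esub> \<in> carrier affine_S4"
    by (simp add: affine_S4_def permutes_id)
  show "x \<otimes>\<^bsub>affine_S4\<^esub> y \<otimes>\<^bsub>affine_S4\<^esub> z = x \<otimes>\<^bsub>affine_S4\<^esub> (y \<otimes>\<^bsub>affine_S4\<^esub> z)" for x y z
    by (auto simp: affine_S4_def add.assoc split: prod.splits)
  show "\<one>\<^bsub>affine_S4\<^esub> \<otimes>\<^bsub>affine_S4\<^esub> x = x" for x
    by (auto simp: affine_S4_def split: prod.splits)
next
  fix x assume "x \<in> carrier affine_S4"
  then obtain p v where x: "x = (p, v)" and p: "p permutes {1..4}"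
    and v: "\<And>i. i \<notin> {1..4} \<Longrightarrow> v i = 0"
    by (auto simp: affine_S4_def)
  let ?y = "(inv' p, \<lambda>i. - v (inv' p i))"
  have "v (inv' p i) = 0" if "i \<notin> {1..4}" for i
    using v that permutes_not_in[OF permutes_inv[OF p] that] by simp
  then have "?y \<in> carrier affine_S4"
    using permutes_inv[OF p] by (simp add: affine_S4_def)
  moreover have "?y \<otimes>\<^bsub>affine_S4\<^esub> x = \<one>\<^bsub>affine_S4\<^esub>"
    using permutes_inv_o(2)[OF p] permutes_inverses(2)[OF p] by (simp add: x affine_S4_def)
  ultimately show "\<exists>y\<in>carrier affine_S4. y \<otimes>\<^bsub>affine_S4\<^esub> x = \<one>\<^bsub>affine_S4\<^esub>" by blast
qed

lemma affine_S4_hom: "fst \<in> hom affine_S4 (sym_group 4)"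
  by (auto simp: hom_def affine_S4_def sym_group_def)

lemma affine_S4_mult: "x \<otimes>\<^bsub>affine_S4\<^esub> y = (fst x \<circ> fst y, \<lambda>i. snd x (fst y i) + snd y i)"
  by (simp add: affine_S4_def split: prod.splits)

lemma affine_S4_one: "\<one>\<^bsub>affine_S4\<^esub> = (id, \<lambda>_. 0)"
  by (simp add: affine_S4_def)

lemma affine_S4_carrier:
  "x \<in> carrier affine_S4 \<longleftrightarrow> fst x permutes {1..4} \<and> (\<forall>i. i \<notin> {1..4} \<longrightarrow> snd x i = 0)"
  by (cases x) (simp add: affine_S4_def)

lemma affine_S4_outside:
  assumes "x \<in> carrier affine_S4" "i \<notin> {1..4}"
  shows "fst x i = i" "snd x i = 0"
  using assms permutes_not_in[of "fst x" "{1..4}" i] unfolding affine_S4_carrier by blast+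

definition coord_sum :: "(nat \<Rightarrow> rat) \<Rightarrow> rat" where
  "coord_sum v = v 1 + v 2 + v 3 + v 4"

lemma coord_sum_eq: "coord_sum v = (\<Sum>i\<in>{1..4}. v i)"
  unfolding coord_sum_def atLeastAtMost_1_4 by simp

text \<open>The function has the form of the second component of a product, so the coordinate sum is
  a homomorphism from \<open>affine_S4\<close> to the additive rationals.\<close>

lemma coord_sum_permutes:
  assumes "p permutes {1..4}"
  shows "coord_sum (\<lambda>i. v (p i) + w i) = coord_sum v + coord_sum w"
  using sum.permute[OF assms, of v] by (simp add: coord_sum_eq sum.distrib comp_def)

definition affine_act :: "(nat \<Rightarrow> rat) \<Rightarrow> (nat \<Rightarrow> nat) \<times> (nat \<Rightarrow> rat) \<Rightarrow> nat \<Rightarrow> rat" where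
  "affine_act x g = (\<lambda>i. x (fst g i) + snd g i)"

lemma affine_act_mult: "affine_act x (g \<otimes>\<^bsub>affine_S4\<^esub> h) = affine_act (affine_act x g) h"
  by (simp add: affine_act_def affine_S4_mult add.assoc)

section \<open>Braid pairs in the affine group with nontrivial even linear part of \<open>c\<close>
  and zero coordinate sums\<close>

context
  fixes c u
  assumes cu: "braid_pair affine_S4 c u"
    and alt: "fst c \<in> A4" "fst c \<noteq> id" "\<And>n. fst (u n) \<in> A4"
    and sum: "coord_sum (snd c) = 0" "\<And>n. coord_sum (snd (u n)) = 0"
begin

interpretation E: group affine_S4 by (rule group_affine_S4)

abbreviation "aff_conj \<equiv> E.conj_seq c u"

lemmas affine_pair_closed = E.braid_pair_closed[OF cu] E.conj_seq_closed[OF cu]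

lemma aff_conj_step: "aff_conj (n + 1) = aff_conj n \<otimes>\<^bsub>affine_S4\<^esub> c"
  using E.conj_seq_step[OF cu, of "n - 1"] by (simp add: algebra_simps)

lemma aff_conj_eq: "u n \<otimes>\<^bsub>affine_S4\<^esub> aff_conj n = c \<otimes>\<^bsub>affine_S4\<^esub> u n"
  using E.conj_seq_eq[OF cu] .

lemma aff_conj_square: "u n \<otimes>\<^bsub>affine_S4\<^esub> (aff_conj n \<otimes>\<^bsub>affine_S4\<^esub> aff_conj n) = (c \<otimes>\<^bsub>affine_S4\<^esub> c) \<otimes>\<^bsub>affine_S4\<^esub> u n"
proof -
  note [simp] = affine_pair_closed
  have "u n \<otimes>\<^bsub>affine_S4\<^esub> (aff_conj n \<otimes>\<^bsub>affine_S4\<^esub> aff_conj n) = (u n \<otimes>\<^bsub>affine_S4\<^esub> aff_conj n) \<otimes>\<^bsub>affine_S4\<^esub> aff_conj n"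
    by (simp add: E.m_assoc)
  also have "\<dots> = c \<otimes>\<^bsub>affine_S4\<^esub> (u n \<otimes>\<^bsub>affine_S4\<^esub> aff_conj n)"
    unfolding aff_conj_eq by (simp add: E.m_assoc aff_conj_eq)
  also have "\<dots> = (c \<otimes>\<^bsub>affine_S4\<^esub> c) \<otimes>\<^bsub>affine_S4\<^esub> u n"
    unfolding aff_conj_eq by (simp add: E.m_assoc)
  finally show ?thesis .
qed

lemma aff_conj_fst: "fst (u n) \<circ> fst (aff_conj n) = fst c \<circ> fst (u n)" "fst (aff_conj (n + 1)) = fst (aff_conj n) \<circ> fst c"
  using arg_cong[OF aff_conj_eq[of n], of fst] arg_cong[OF aff_conj_step[of n], of fst]
  by (simp_all add: affine_S4_mult)

lemmas affine_pair_V4 = A4_pair_V4[of "fst c" "\<lambda>n. fst (u n)" "\<lambda>n. fst (aff_conj n)", OF alt aff_conj_fst]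
lemmas affine_pair_ne = A4_pair_conj_ne[of "fst c" "\<lambda>n. fst (u n)" "\<lambda>n. fst (aff_conj n)", OF alt aff_conj_fst]
lemmas affine_pair_not_V4 = A4_pair_not_V4[of "fst c" "\<lambda>n. fst (u n)" "\<lambda>n. fst (aff_conj n)", OF alt aff_conj_fst]

lemma affine_pair_rel: "u (n + 1) = u n \<otimes>\<^bsub>affine_S4\<^esub> u (n + 2)"
  using cu by (simp add: braid_pair_def)

text \<open>The square of \<open>c\<close> is a nonzero translation by a vector \<open>z\<close>
  fixed by \<open>fst c\<close> and negated by every \<open>fst (aff_conj n)\<close>. The squares of
  the conjugates are translations by \<open>z \<circ> fst (u n)\<close>; their periodicity is what
  \<open>A4_pair_periodic\<close> asks for.\<close>

lemma affine_periodic: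
  assumes cc: "c \<otimes>\<^bsub>affine_S4\<^esub> c \<noteq> \<one>\<^bsub>affine_S4\<^esub>"
  shows "fst (u (n + 2)) = fst (u n)"
proof -
  define z where "z = (\<lambda>i. snd c (fst c i) + snd c i)"
  have C2: "fst c \<circ> fst c = id"
    using V4_comp(3) affine_pair_V4(1) by blast
  have cz: "c \<otimes>\<^bsub>affine_S4\<^esub> c = (id, z)"
    by (simp add: affine_S4_mult C2 z_def)
  have zC: "z (fst c i) = z i" for i
    using C2 by (simp add: z_def fun_eq_iff add.commute)
  have z0: "z i = 0" if "i \<notin> {1..4}" for i
    using affine_pair_closed(1) that permutes_not_in[of "fst c" "{1..4}" i] by (simp add: z_def affine_S4_carrier)
  have zsum: "z 1 + z 2 + z 3 + z 4 = 0"
    using coord_sum_permutes[of "fst c" "snd c" "snd c"] affine_pair_closed(1) sum(1)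
    by (simp add: z_def coord_sum_def affine_S4_carrier)
  have "\<exists>i\<in>{1..4}. z i \<noteq> 0"
  proof (rule ccontr)
    assume "\<not> (\<exists>i\<in>{1..4}. z i \<noteq> 0)"
    then have "z i = 0" for i using z0 by (cases "i \<in> {1..4}") blast+
    then have "z = (\<lambda>_. 0)" by (simp add: fun_eq_iff)
    then show False using cc cz by (simp add: affine_S4_one)
  qed
  then obtain i where i: "i \<in> {1..4}" "z i \<noteq> 0" by blast
  have neg: "z (fst (aff_conj n) j) = - z j" for n j
  proof (cases "j \<in> {1..4}")
    case True
    then show ?thesis
      using V4_negates_fixed_vector[OF affine_pair_V4(1) affine_pair_V4(2)[of n] alt(2) affine_pair_ne(1)[of n] _ _ zsum True]
        affine_pair_ne(2)[of n] zC by metis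
  next
    case False
    then have "fst (aff_conj n) j = j"
      using affine_S4_outside(1) affine_pair_closed(3) by blast
    then show ?thesis using z0[OF False] by simp
  qed
  have W2: "fst (aff_conj n) \<circ> fst (aff_conj n) = id" for n
    using V4_comp(3) affine_pair_V4(2) by blast
  have w2: "aff_conj n \<otimes>\<^bsub>affine_S4\<^esub> aff_conj n = (id, z \<circ> fst (u n))" for n
  proof -
    have "snd (u n \<otimes>\<^bsub>affine_S4\<^esub> (aff_conj n \<otimes>\<^bsub>affine_S4\<^esub> aff_conj n)) = snd ((id, z) \<otimes>\<^bsub>affine_S4\<^esub> u n)"
      by (simp only: aff_conj_square cz)
    moreover have "fst (aff_conj n \<otimes>\<^bsub>affine_S4\<^esub> aff_conj n) = id"
      using W2 by (simp add: affine_S4_mult)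
    moreover obtain x where "aff_conj n \<otimes>\<^bsub>affine_S4\<^esub> aff_conj n = (id, x)"
      using calculation(2) by (metis prod.collapse)
    ultimately show ?thesis
      by (simp add: affine_S4_mult[of "u n"] affine_S4_mult[of "(id, z)"] fun_eq_iff)
  qed
  have "z \<circ> fst (u (m + 2)) = z \<circ> fst (u m)" for m
  proof -
    have w3: "aff_conj (m + 2) = aff_conj m \<otimes>\<^bsub>affine_S4\<^esub> (id, z)"
      using E.conj_seq_shift[OF cu, of "m - 1"] by (simp add: cz add.commute)
    \<comment> \<open>In the square of \<open>aff_conj m\<close> times the translation by
      \<open>z\<close> the two translations cancel, since \<open>aff_conj m\<close> negates
      \<open>z\<close>.\<close>
    have "snd (aff_conj (m + 2) \<otimes>\<^bsub>affine_S4\<^esub> aff_conj (m + 2)) i = snd (aff_conj m \<otimes>\<^bsub>affine_S4\<^esub> aff_conj m) i" for i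
      using neg[of m i] by (simp add: w3 affine_S4_mult)
    then show ?thesis
      by (simp add: w2 fun_eq_iff)
  qed
  moreover have "fst (u (m + 1)) = fst (u m) \<circ> fst (u (m + 2))" for m
    using arg_cong[OF affine_pair_rel[of m], of fst] by (simp add: affine_S4_mult)
  moreover have "z \<circ> fst c = z"
    using zC by (simp add: fun_eq_iff)
  ultimately show ?thesis
    using A4_pair_periodic[of "fst c" "\<lambda>n. fst (u n)" "\<lambda>n. fst (aff_conj n)", OF alt aff_conj_fst, of z i n] zsum i by blast
qed

text \<open>Here \<open>c\<close> and its conjugates form, with the identity, a Klein four-group
  fixing a barycentre \<open>x\<close>. The image of \<open>x\<close> under \<open>u n\<close> is
  fixed by two conjugates with distinct linear parts, which forces it to be
  \<open>x\<close>.\<close>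

lemma affine_fixed_point:
  assumes cc: "c \<otimes>\<^bsub>affine_S4\<^esub> c = \<one>\<^bsub>affine_S4\<^esub>"
  shows "\<exists>x. affine_act x c = x \<and> (\<forall>n. affine_act x (u n) = x)"
proof -
  note [simp] = affine_pair_closed
  let ?e = "\<one>\<^bsub>affine_S4\<^esub>"
  let ?a = "aff_conj 0" and ?b = "aff_conj 1"
  have b: "?b = ?a \<otimes>\<^bsub>affine_S4\<^esub> c"
    using aff_conj_step[of 0] by simp
  have shift: "aff_conj (n + 2) = aff_conj n" for n
    using E.conj_seq_shift[OF cu, of "n - 1"] by (simp add: cc add.commute)
  have w2: "aff_conj n \<otimes>\<^bsub>affine_S4\<^esub> aff_conj n = ?e" for n
  proof -
    have "u n \<otimes>\<^bsub>affine_S4\<^esub> (aff_conj n \<otimes>\<^bsub>affine_S4\<^esub> aff_conj n) = u n"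
      by (simp add: aff_conj_square cc)
    then show ?thesis by simp
  qed
  \<comment> \<open>The squares of \<open>?a\<close>, of \<open>c\<close> and of their product
    \<open>?b\<close> are trivial, so \<open>?a\<close> and \<open>c\<close> commute.\<close>
  have comm: "c \<otimes>\<^bsub>affine_S4\<^esub> ?a = ?a \<otimes>\<^bsub>affine_S4\<^esub> c"
  proof -
    have "?a \<otimes>\<^bsub>affine_S4\<^esub> (?b \<otimes>\<^bsub>affine_S4\<^esub> ?b) \<otimes>\<^bsub>affine_S4\<^esub> c = ?a \<otimes>\<^bsub>affine_S4\<^esub> c"
      by (simp add: w2)
    moreover have "?a \<otimes>\<^bsub>affine_S4\<^esub> (?b \<otimes>\<^bsub>affine_S4\<^esub> ?b) \<otimes>\<^bsub>affine_S4\<^esub> c =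
        (?a \<otimes>\<^bsub>affine_S4\<^esub> ?a) \<otimes>\<^bsub>affine_S4\<^esub> (c \<otimes>\<^bsub>affine_S4\<^esub> ?a) \<otimes>\<^bsub>affine_S4\<^esub> (c \<otimes>\<^bsub>affine_S4\<^esub> c)"
      by (simp add: b E.m_assoc)
    ultimately show ?thesis
      by (simp add: w2 cc)
  qed
  \<comment> \<open>The barycentre of the orbit of the origin under the identity, \<open>c\<close>,
    \<open>?a\<close>, \<open>?b\<close>: a second component is the image of the origin, and the
    identity contributes 0.\<close>
  define x where "x = (\<lambda>i. (snd c i + snd ?a i + snd ?b i) / 4)"
  have avg: "affine_act x g = (\<lambda>i. (snd g i + snd (c \<otimes>\<^bsub>affine_S4\<^esub> g) i +
      snd (?a \<otimes>\<^bsub>affine_S4\<^esub> g) i + snd (?b \<otimes>\<^bsub>affine_S4\<^esub> g) i) / 4)" for g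
    by (simp add: affine_act_def x_def affine_S4_mult field_simps)
  have bc: "?b \<otimes>\<^bsub>affine_S4\<^esub> c = ?a"
    by (simp add: b E.m_assoc cc)
  have xc: "affine_act x c = x"
    unfolding avg by (simp add: cc bc b[symmetric] x_def affine_S4_one algebra_simps)
  have ba: "?b \<otimes>\<^bsub>affine_S4\<^esub> ?a = c"
    using w2[of 0] by (simp add: b comm[symmetric] E.m_assoc)
  have xa: "affine_act x ?a = x"
    unfolding avg by (simp add: w2 comm ba b[symmetric] x_def affine_S4_one algebra_simps)
  have xw: "affine_act x (aff_conj n) = x" for n
  proof -
    have xb: "affine_act x ?b = x"
      by (simp add: b affine_act_mult xa xc)
    have "aff_conj n = aff_conj (n mod 2)"
      by (rule periodic_eq_parity) (rule shift)
    moreover have "n mod 2 = 0 \<or> n mod 2 = 1" by presburger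
    ultimately show ?thesis using xa xb by auto
  qed
  have "affine_act x (u n) = x" for n
  proof -
    let ?y = "affine_act x (u n)"
    define d where "d = (\<lambda>i. ?y i - x i)"
    have yw: "affine_act ?y (aff_conj n) = ?y"
      by (simp only: affine_act_mult[symmetric] aff_conj_eq) (simp add: affine_act_mult xc)
    \<comment> \<open>The other conjugation by \<open>u n\<close>, carrying
      \<open>aff_conj (n - 2)\<close> to \<open>aff_conj (n - 1)\<close>.\<close>
    have yw': "affine_act ?y (aff_conj (n - 1)) = ?y"
    proof -
      have "aff_conj (n - 2) \<otimes>\<^bsub>affine_S4\<^esub> u n = u n \<otimes>\<^bsub>affine_S4\<^esub> aff_conj (n - 1)"
        using E.conj_seq_conj[OF cu, of "n - 2"] by simp
      then show ?thesis
        by (metis affine_act_mult xw)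
    qed
    have dw: "d (fst g i) = d i" if "affine_act ?y g = ?y" "affine_act x g = x" for g i
      using fun_cong[OF that(1), of i] fun_cong[OF that(2), of i]
      by (simp add: d_def affine_act_def)
    have "coord_sum ?y = coord_sum x"
      using coord_sum_permutes[of "fst (u n)" x "snd (u n)"] affine_pair_closed(2)[of n] sum(2)
      by (simp add: affine_act_def affine_S4_carrier)
    then have dsum: "d 1 + d 2 + d 3 + d 4 = 0"
      by (simp add: d_def coord_sum_def)
    have "d i = 0" for i
    proof (cases "i \<in> {1..4}")
      case True
      \<comment> \<open>The linear part of \<open>aff_conj n\<close> fixes \<open>d\<close>, so the
        different one of \<open>aff_conj (n - 1)\<close> negates it; but that one fixes
        \<open>d\<close> too.\<close>
      have "fst (aff_conj n) \<noteq> fst (aff_conj (n - 1))"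
      proof
        assume "fst (aff_conj n) = fst (aff_conj (n - 1))"
        then have "fst (aff_conj (n - 1)) = fst (aff_conj (n - 1)) \<circ> fst c"
          using aff_conj_fst(2)[of "n - 1"] by simp
        then have "fst (aff_conj (n - 1)) \<circ> fst (aff_conj (n - 1)) = fst (aff_conj (n - 1)) \<circ> fst (aff_conj (n - 1)) \<circ> fst c"
          by (metis comp_assoc)
        then show False
          using V4_comp(3)[OF affine_pair_V4(2) affine_pair_V4(2)] alt(2) by simp
      qed
      then have "d (fst (aff_conj (n - 1)) i) = - d i"
        using V4_negates_fixed_vector[OF affine_pair_V4(2)[of n] affine_pair_V4(2)[of "n - 1"] affine_pair_ne(1) affine_pair_ne(1) _ _ dsum True]
          dw[OF yw xw] by blast
      then show ?thesis
        using dw[OF yw' xw, of i] by simp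
    next
      case False
      then have "fst (u n) i = i" "snd (u n) i = 0"
        using affine_S4_outside affine_pair_closed(2) by blast+
      then show ?thesis by (simp add: d_def affine_act_def)
    qed
    then show ?thesis
      by (simp add: d_def fun_eq_iff)
  qed
  with xc show ?thesis by blast
qed

end

section \<open>Lifting homomorphisms\<close>

text \<open>A homomorphism \<open>h\<close> on \<open>B\<^sub>4'\<close> extends to \<open>B\<^sub>4\<close> with values in this group, the component \<open>n\<close> of the
  image of \<open>g\<close> being \<open>h (\<sigma>\<^sub>1\<^sup>n g \<sigma>\<^sub>1\<^sup>-\<^sup>n)\<close>.\<close>

definition shift_product :: "('a, 'b) monoid_scheme \<Rightarrow> ((int \<Rightarrow> 'a) \<times> int) monoid" where
  "shift_product T =
    \<lparr>carrier = {(F, k). \<forall>n. F n \<in> carrier T},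
     mult = (\<lambda>(F, k) (F', k'). (\<lambda>n. F n \<otimes>\<^bsub>T\<^esub> F' (n + k), k + k')),
     one = (\<lambda>_. \<one>\<^bsub>T\<^esub>, 0)\<rparr>"

lemma shift_product_mult:
  "x \<otimes>\<^bsub>shift_product T\<^esub> y = (\<lambda>n. fst x n \<otimes>\<^bsub>T\<^esub> fst y (n + snd x), snd x + snd y)"
  by (simp add: shift_product_def split: prod.splits)

lemma shift_product_one: "\<one>\<^bsub>shift_product T\<^esub> = (\<lambda>_. \<one>\<^bsub>T\<^esub>, 0)"
  by (simp add: shift_product_def)

lemma shift_product_carrier: "x \<in> carrier (shift_product T) \<longleftrightarrow> (\<forall>n. fst x n \<in> carrier T)"
  by (cases x) (simp add: shift_product_def)

lemma group_shift_product:
  assumes "group T"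
  shows "group (shift_product T)"
proof -
  interpret T: group T by (rule assms)
  show ?thesis
  proof (rule groupI)
    fix x assume x: "x \<in> carrier (shift_product T)"
    let ?y = "(\<lambda>n. inv\<^bsub>T\<^esub> (fst x (n - snd x)), - snd x)"
    have "?y \<in> carrier (shift_product T)" "?y \<otimes>\<^bsub>shift_product T\<^esub> x = \<one>\<^bsub>shift_product T\<^esub>"
      using x by (simp_all add: shift_product_carrier shift_product_mult shift_product_one)
    then show "\<exists>y\<in>carrier (shift_product T). y \<otimes>\<^bsub>shift_product T\<^esub> x = \<one>\<^bsub>shift_product T\<^esub>"
      by blast
  qed (simp_all add: shift_product_carrier shift_product_mult shift_product_one T.m_assoc add.assoc)
qed

lemma hom_restrict_subgroup: "h \<in> hom G K \<Longrightarrow> H \<subseteq> carrier G \<Longrightarrow> h \<in> hom (G\<lparr>carrier := H\<rparr>) K"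
  by (auto simp: hom_def)

lemma B4'_subset: "B4' \<subseteq> carrier B4"
  using subgroup_B4' by (rule subgroup.subset)

text \<open>In the shift product the braid relation between the images of \<open>sigma1\<close> and
  \<open>sigma2\<close> is exactly the recurrence for \<open>U\<close>. The desired homomorphism is
  the component at 0 on \<open>B4'\<close>.\<close>

lemma hom_exists_of_recurrence:
  assumes T: "group T" and U: "\<And>n. U n \<in> carrier T" "\<And>n. U (n + 1) = U n \<otimes>\<^bsub>T\<^esub> U (n + 2)"
  shows "\<exists>h\<in>hom G4 T. h c4 = \<one>\<^bsub>T\<^esub> \<and> (\<forall>n. h (u4 n) = U n)"
proof -
  interpret T: group T by (rule T)
  let ?W = "shift_product T"
  interpret W: group ?W by (rule group_shift_product[OF T])
  have "\<exists>h\<in>hom B4 ?W. h sigma1 = (\<lambda>_. \<one>\<^bsub>T\<^esub>, 1) \<and> h sigma2 = (U, 1) \<and> h sigma3 = (\<lambda>_. \<one>\<^bsub>T\<^esub>, 1)"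
    by (rule B4_hom_exists[OF W.is_group]) (simp_all add: shift_product_carrier shift_product_mult U)
  then obtain g where g: "g \<in> hom B4 ?W" and gs: "g sigma1 = (\<lambda>_. \<one>\<^bsub>T\<^esub>, 1)" "g sigma2 = (U, 1)"
    "g sigma3 = (\<lambda>_. \<one>\<^bsub>T\<^esub>, 1)" by blast
  interpret g: group_hom B4 ?W g
    using g by (simp add: group_hom_def group_hom_axioms_def B4.is_group W.is_group)
  have "snd \<in> hom ?W integer_group"
    by (simp add: hom_def shift_product_mult)
  then have "(snd \<circ> g) \<in> hom B4 integer_group"
    using g hom_compose by blast
  \<comment> \<open>On \<open>B4'\<close> the integer component vanishes, so no shift occurs and the
    component at 0 is multiplicative.\<close>
  then have snd0: "snd (g x) = 0" if "x \<in> B4'" for x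
    using hom_trivial_on_derived[OF B4.is_group abelian_integer_group, of "snd \<circ> g" x] that
    by (simp add: braid_commutator_subgroup_def)
  define h where "h = (\<lambda>x. fst (g x) 0)"
  have gc: "fst (g x) n \<in> carrier T" if "x \<in> carrier B4" for x n
    using g.hom_closed[OF that] by (simp add: shift_product_carrier)
  have "h \<in> hom G4 T"
  proof (rule homI)
    show "h x \<in> carrier T" if "x \<in> carrier G4" for x
      using that B4'_subset gc by (auto simp: h_def)
    show "h (x \<otimes>\<^bsub>G4\<^esub> y) = h x \<otimes>\<^bsub>T\<^esub> h y" if "x \<in> carrier G4" "y \<in> carrier G4" for x y
    proof -
      have "x \<in> carrier B4" "y \<in> carrier B4" using that B4'_subset by auto
      then show ?thesis
        using that snd0[of x] by (simp add: h_def shift_product_mult)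
    qed
  qed
  moreover have "h c4 = \<one>\<^bsub>T\<^esub>"
  proof -
    have "g c4 = \<one>\<^bsub>?W\<^esub>"
      unfolding c4_def by (simp add: gs(1)[symmetric] gs(3))
    then show ?thesis by (simp add: h_def shift_product_one)
  qed
  moreover have "h (u4 n) = U n" for n
  proof -
    \<comment> \<open>Conjugation by \<open>sigma1\<close> raises the index of \<open>u4\<close> by
      one and shifts the argument of the first component by one.\<close>
    have up: "fst (g (u4 (n + 1))) m = fst (g (u4 n)) (m + 1)" for n m
    proof -
      have "sigma1 \<otimes>\<^bsub>B4\<^esub> u4 n = u4 (n + 1) \<otimes>\<^bsub>B4\<^esub> sigma1"
        by (simp add: u4_conj(1)[symmetric] B4.m_assoc)
      then have "g sigma1 \<otimes>\<^bsub>?W\<^esub> g (u4 n) = g (u4 (n + 1)) \<otimes>\<^bsub>?W\<^esub> g sigma1"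
        using g.hom_mult[of sigma1 "u4 n"] g.hom_mult[of "u4 (n + 1)" sigma1] by simp
      then show ?thesis
        using gc by (simp add: shift_product_mult gs fun_eq_iff)
    qed
    have "u4 0 \<otimes>\<^bsub>B4\<^esub> sigma1 = sigma2"
      by (simp add: u4_def B4.m_assoc)
    then have "g (u4 0) \<otimes>\<^bsub>?W\<^esub> g sigma1 = g sigma2"
      using g.hom_mult[of "u4 0" sigma1] by simp
    then have base: "fst (g (u4 0)) m = U m" for m
      using gc by (simp add: shift_product_mult gs fun_eq_iff)
    have "\<forall>m. fst (g (u4 n)) m = U (m + n)"
    proof (induction n rule: int_induct[where k = 0])
      case base
      then show ?case using \<open>\<And>m. fst (g (u4 0)) m = U m\<close> by simp
    next
      case (step1 i)
      then show ?case using up[of i] by (simp add: algebra_simps)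
    next
      case (step2 i)
      show ?case
      proof
        fix m
        have "fst (g (u4 i)) (m - 1) = fst (g (u4 (i - 1))) m"
          using up[of "i - 1" "m - 1"] by simp
        then show "fst (g (u4 (i - 1))) m = U (m + (i - 1))"
          using step2(2) by (simp add: algebra_simps)
      qed
    qed
    then show ?thesis by (simp add: h_def)
  qed
  ultimately show ?thesis by blast
qed

text \<open>Two consecutive values determine the sequence in both directions and may be chosen
  freely; this is how the freeness of the commutator subgroup on three strings enters.\<close>

lemma (in group) recurrence_exists:
  assumes xy: "x \<in> carrier G" "y \<in> carrier G"
  shows "\<exists>U :: int \<Rightarrow> 'a. U 0 = x \<and> U 1 = y \<and> (\<forall>n. U n \<in> carrier G) \<and> (\<forall>n. U (n + 1) = U n \<otimes> U (n + 2))"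
proof -
  \<comment> \<open>\<open>P k\<close> holds the values at \<open>k\<close> and
    \<open>k + 1\<close>, solved forwards; \<open>Q k\<close> holds those at \<open>- k\<close> and
    \<open>1 - k\<close>, solved backwards. Both start from the same pair.\<close>
  define P where "P = rec_nat (x, y) (\<lambda>_ (a, b). (b, inv a \<otimes> b))"
  define Q where "Q = rec_nat (x, y) (\<lambda>_ (a, b). (a \<otimes> inv b, a))"
  have P: "P 0 = (x, y)" "P (Suc k) = (snd (P k), inv (fst (P k)) \<otimes> snd (P k))" for k
    by (simp_all add: P_def split: prod.split)
  have Q: "Q 0 = (x, y)" "Q (Suc k) = (fst (Q k) \<otimes> inv (snd (Q k)), fst (Q k))" for k
    by (simp_all add: Q_def split: prod.split)
  have Pc: "fst (P k) \<in> carrier G \<and> snd (P k) \<in> carrier G" for k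
    by (induction k) (use xy in \<open>simp_all add: P\<close>)
  have Qc: "fst (Q k) \<in> carrier G \<and> snd (Q k) \<in> carrier G" for k
    by (induction k) (use xy in \<open>simp_all add: Q\<close>)
  define R where "R = (\<lambda>n::int. if n \<ge> 0 then P (nat n) else Q (nat (- n)))"
  have Rc: "fst (R n) \<in> carrier G" "snd (R n) \<in> carrier G" for n
    using Pc Qc by (simp_all add: R_def)
  have R: "snd (R n) = fst (R (n + 1)) \<and> snd (R n) = fst (R n) \<otimes> snd (R (n + 1))" for n
  proof (cases "n \<ge> 0")
    case True
    then have "R (n + 1) = (snd (R n), inv (fst (R n)) \<otimes> snd (R n))"
      by (simp add: R_def nat_add_distrib P)
    then show ?thesis using Rc[of n] by (simp add: cancel_inv)
  next
    case False
    then have "R n = (fst (R (n + 1)) \<otimes> inv (snd (R (n + 1))), fst (R (n + 1)))"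
    proof -
      have "nat (- n) = Suc (nat (- (n + 1)))" using False by simp
      moreover have "R (n + 1) = Q (nat (- (n + 1)))"
        using False by (cases "n = -1") (simp_all add: R_def P Q)
      ultimately show ?thesis using False by (simp add: R_def Q)
    qed
    then show ?thesis using Rc[of "n + 1"] by (simp add: m_assoc)
  qed
  define U where "U = (\<lambda>n. fst (R n))"
  have "U (n + 1) = U n \<otimes> U (n + 2)" for n
    using R[of n] R[of "n + 1"] unfolding U_def by (metis add.assoc one_add_one)
  moreover have "U 0 = x" "U 1 = y"
    using R[of 0] by (simp_all add: U_def R_def P)
  ultimately show ?thesis
    using Rc by (auto simp: U_def)
qed

text \<open>Lift the values at \<open>u4 0\<close> and \<open>u4 1\<close> arbitrarily and extend by
  the recurrence. The recurrence holds in \<open>K\<close> as well, so the lifts project correctly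
  at every index.\<close>

lemma lift_of_hom_trivial_on_c4:
  assumes T: "group T" and K: "group K" and pi: "pi \<in> hom T K" "carrier K \<subseteq> pi ` carrier T"
    and f: "f \<in> hom G4 K" "f c4 = \<one>\<^bsub>K\<^esub>"
  shows "\<exists>h\<in>hom G4 T. \<forall>x\<in>B4'. pi (h x) = f x"
proof -
  interpret T: group T by (rule T)
  interpret K: group K by (rule K)
  interpret pi: group_hom T K pi
    using pi(1) by (simp add: group_hom_def group_hom_axioms_def T K)
  interpret f: group_hom G4 K f
    using f(1) by (simp add: group_hom_def group_hom_axioms_def group_G4 K)
  have fu: "f (u4 n) \<in> carrier K" for n
    using f.hom_closed[of "u4 n"] c4_u4_in_B4' by simp
  have "f (u4 0) \<in> pi ` carrier T" "f (u4 1) \<in> pi ` carrier T"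
    using pi(2) fu by blast+
  then obtain x y where xy: "x \<in> carrier T" "pi x = f (u4 0)" "y \<in> carrier T" "pi y = f (u4 1)"
    by auto
  obtain U :: "int \<Rightarrow> _" where U: "U 0 = x" "U 1 = y" "\<And>n. U n \<in> carrier T" "\<And>n. U (n + 1) = U n \<otimes>\<^bsub>T\<^esub> U (n + 2)"
    using T.recurrence_exists[OF xy(1,3)] by blast
  obtain h where h: "h \<in> hom G4 T" "h c4 = \<one>\<^bsub>T\<^esub>" "\<And>n. h (u4 n) = U n"
    using hom_exists_of_recurrence[OF T, of U] U(3,4) by blast
  have fU: "f (u4 (n + 1)) = f (u4 n) \<otimes>\<^bsub>K\<^esub> f (u4 (n + 2))" for n
  proof -
    have "u4 (n + 1) = u4 n \<otimes>\<^bsub>G4\<^esub> u4 (n + 2)"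
      using braid_pair_G4 by (simp add: braid_pair_def)
    then show ?thesis
      using f.hom_mult[of "u4 n" "u4 (n + 2)"] c4_u4_in_B4' by simp
  qed
  have piU: "pi (U (n + 1)) = pi (U n) \<otimes>\<^bsub>K\<^esub> pi (U (n + 2))" for n
    using U(3) pi.hom_mult by (simp add: U(4)[of n])
  have piUc: "pi (U n) \<in> carrier K" for n
    using U(3) by simp
  have "pi (U n) = f (u4 n) \<and> pi (U (n + 1)) = f (u4 (n + 1))" for n
  proof (induction n rule: int_induct[where k = 0])
    case base
    then show ?case using U xy by simp
  next
    case (step1 i)
    have "pi (U i) \<otimes>\<^bsub>K\<^esub> pi (U (i + 2)) = pi (U i) \<otimes>\<^bsub>K\<^esub> f (u4 (i + 2))"
      using fU[of i] piU[of i] step1 by simp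
    then have "pi (U (i + 2)) = f (u4 (i + 2))"
      using piUc fu by simp
    then show ?case using step1 by (simp add: add.assoc)
  next
    case (step2 i)
    have "f (u4 i) = f (u4 (i - 1)) \<otimes>\<^bsub>K\<^esub> f (u4 (i + 1))"
      "pi (U i) = pi (U (i - 1)) \<otimes>\<^bsub>K\<^esub> pi (U (i + 1))"
      using fU[of "i - 1"] piU[of "i - 1"] by (simp_all add: add.commute)
    then have "pi (U (i - 1)) \<otimes>\<^bsub>K\<^esub> pi (U (i + 1)) = f (u4 (i - 1)) \<otimes>\<^bsub>K\<^esub> pi (U (i + 1))"
      using step2(2) by metis
    then have "pi (U (i - 1)) = f (u4 (i - 1))"
      using piUc fu by simp
    then show ?case using step2 by simp
  qed
  then have u: "(pi \<circ> h) (u4 n) = f (u4 n)" for n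
    using h(3) by simp
  have c: "(pi \<circ> h) c4 = f c4"
    using h(2) f(2) by simp
  have "pi \<circ> h \<in> hom G4 K"
    using h(1) pi(1) hom_compose by blast
  then have "(pi \<circ> h) x = f x" if "x \<in> B4'" for x
    using hom_eq_on_B4'[OF K _ f(1) c u that] by blast
  then show ?thesis using h(1) by auto
qed

section \<open>Automorphisms of the commutator subgroup\<close>

lemma braid_perm_sigma:
  "braid_perm 4 sigma1 = transpose 1 2" "braid_perm 4 sigma2 = transpose 2 3" "braid_perm 4 sigma3 = transpose 3 4"
proof -
  have "braid_perm 4 sigma1 = transpose 1 (Suc 1)" "braid_perm 4 sigma2 = transpose 2 (Suc 2)"
    "braid_perm 4 sigma3 = transpose 3 (Suc 3)"
    unfolding sigma1_def sigma2_def sigma3_def by (rule braid_perm_generator; simp)+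
  moreover have "Suc 1 = 2" "Suc 2 = 3" "Suc 3 = 4" by simp_all
  ultimately show "braid_perm 4 sigma1 = transpose 1 2" "braid_perm 4 sigma2 = transpose 2 3"
    "braid_perm 4 sigma3 = transpose 3 4"
    by metis+
qed

lemma braid_perm_G4: "braid_perm 4 \<in> hom G4 (alt_group 4)"
proof -
  have sign: "comm_group sign_img"
    by (rule group.group_comm_groupI[OF sign_img_is_group]) (auto simp: sign_img_def)
  have h: "sign \<circ> braid_perm 4 \<in> hom B4 sign_img"
    using braid_perm_hom sign_is_hom hom_compose by blast
  have "evenperm (braid_perm 4 x)" if "x \<in> B4'" for x
    using hom_trivial_on_derived[OF B4.is_group sign h, of x] that
    by (simp add: braid_commutator_subgroup_def sign_img_def sign_def split: if_splits)
  moreover have "braid_perm 4 x permutes {1..4}" if "x \<in> B4'" for x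
    using hom_in_carrier[OF braid_perm_hom] that B4'_subset unfolding sym_group_carrier by blast
  moreover have "braid_perm 4 (x \<otimes>\<^bsub>B4\<^esub> y) = braid_perm 4 x \<circ> braid_perm 4 y" if "x \<in> B4'" "y \<in> B4'" for x y
    using hom_mult[OF braid_perm_hom[of 4], of x y] that B4'_subset by (auto simp: sym_group_mult)
  ultimately show ?thesis
    by (intro homI) (simp_all add: alt_group_carrier alt_group_mult)
qed

lemma braid_J_4: "x \<in> braid_J 4 \<longleftrightarrow> x \<in> B4' \<and> braid_perm 4 x = id"
  using B4'_subset by (auto simp: braid_J_def pure_braid_group_def kernel_def sym_group_one)

lemma braid_perm_c4: "braid_perm 4 c4 = mk_perm 2 1 4 3"
proof -
  interpret group_hom B4 "sym_group 4" "braid_perm 4"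
    using braid_perm_hom by (simp add: group_hom_def group_hom_axioms_def B4.is_group sym_group_is_group)
  have "c4 \<otimes>\<^bsub>B4\<^esub> sigma1 = sigma3"
    by (simp add: c4_def B4.m_assoc)
  then have "braid_perm 4 c4 \<circ> transpose 1 2 = transpose 3 4"
    using hom_mult[of c4 sigma1] by (simp add: braid_perm_sigma sym_group_mult)
  then have "braid_perm 4 c4 \<circ> transpose 1 2 \<circ> transpose 1 2 = transpose 3 4 \<circ> transpose 1 2"
    by (simp only:)
  then show ?thesis
    unfolding transpose_eq_mk_perm by (simp add: comp_assoc mk_perm_id[symmetric, simplified])
qed

text \<open>Conjugation by \<open>sigma1\<close> shifts the index, and the permutation of
  \<open>sigma1\<close> is an involution, whence the period two.\<close>

lemma braid_perm_u4:
  "braid_perm 4 (u4 0) = mk_perm 3 1 2 4" "braid_perm 4 (u4 (n + 2)) = braid_perm 4 (u4 n)"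
proof -
  interpret group_hom B4 "sym_group 4" "braid_perm 4"
    using braid_perm_hom by (simp add: group_hom_def group_hom_axioms_def B4.is_group sym_group_is_group)
  have id12: "id = transpose 1 (2::nat) \<circ> transpose 1 2" by simp
  have "u4 0 \<otimes>\<^bsub>B4\<^esub> sigma1 = sigma2"
    by (simp add: u4_def B4.m_assoc)
  then have "braid_perm 4 (u4 0) \<circ> transpose 1 2 = transpose 2 3"
    using hom_mult[of "u4 0" sigma1] by (simp add: braid_perm_sigma sym_group_mult)
  then have "braid_perm 4 (u4 0) \<circ> transpose 1 2 \<circ> transpose 1 2 = transpose 2 3 \<circ> transpose 1 2"
    by (simp only:)
  then show "braid_perm 4 (u4 0) = mk_perm 3 1 2 4"
    unfolding transpose_eq_mk_perm by (simp add: comp_assoc mk_perm_id[symmetric, simplified])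
  have step: "braid_perm 4 (u4 (m + 1)) \<circ> transpose 1 2 = transpose 1 2 \<circ> braid_perm 4 (u4 m)" for m
  proof -
    have "u4 (m + 1) \<otimes>\<^bsub>B4\<^esub> sigma1 = sigma1 \<otimes>\<^bsub>B4\<^esub> u4 m"
      by (simp add: u4_conj(1)[symmetric] B4.m_assoc)
    then show ?thesis
      using hom_mult[of "u4 (m + 1)" sigma1] hom_mult[of sigma1 "u4 m"]
      by (simp add: braid_perm_sigma sym_group_mult)
  qed
  have "braid_perm 4 (u4 (n + 2)) = braid_perm 4 (u4 (n + 1 + 1)) \<circ> transpose 1 2 \<circ> transpose 1 2"
    by (simp add: comp_assoc add.assoc)
  also have "\<dots> = transpose 1 2 \<circ> (braid_perm 4 (u4 (n + 1)) \<circ> transpose 1 2)"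
    by (simp only: step comp_assoc)
  also have "\<dots> = braid_perm 4 (u4 n)"
    by (simp only: step) (simp add: comp_assoc[symmetric])
  finally show "braid_perm 4 (u4 (n + 2)) = braid_perm 4 (u4 n)" .
qed

text \<open>The linear parts agree with \<open>braid_perm\<close> on generators, and the coordinate
  sum is a homomorphism to an abelian group, hence zero on \<open>B4'\<close>.\<close>

lemma affine_rep_exists:
  "\<exists>h\<in>hom B4 affine_S4. (\<forall>x\<in>B4'. fst (h x) = braid_perm 4 x \<and> coord_sum (snd (h x)) = 0) \<and>
    \<not> (\<exists>x. affine_act x (h c4) = x)"
proof -
  let ?s = "\<lambda>i::nat. (transpose i (Suc i), \<lambda>j. if j = i \<or> j = Suc i then 1 else 0) :: (nat \<Rightarrow> nat) \<times> (nat \<Rightarrow> rat)"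
  have "\<exists>h\<in>hom B4 affine_S4. h sigma1 = ?s 1 \<and> h sigma2 = ?s 2 \<and> h sigma3 = ?s 3"
  proof (rule B4_hom_exists[OF group_affine_S4])
    show "?s 1 \<in> carrier affine_S4" "?s 2 \<in> carrier affine_S4" "?s 3 \<in> carrier affine_S4"
      by (auto simp: affine_S4_carrier intro!: permutes_swap_id)
    show "?s 1 \<otimes>\<^bsub>affine_S4\<^esub> ?s 3 = ?s 3 \<otimes>\<^bsub>affine_S4\<^esub> ?s 1"
      "?s 1 \<otimes>\<^bsub>affine_S4\<^esub> ?s 2 \<otimes>\<^bsub>affine_S4\<^esub> ?s 1 = ?s 2 \<otimes>\<^bsub>affine_S4\<^esub> ?s 1 \<otimes>\<^bsub>affine_S4\<^esub> ?s 2"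
      "?s 3 \<otimes>\<^bsub>affine_S4\<^esub> ?s 2 \<otimes>\<^bsub>affine_S4\<^esub> ?s 3 = ?s 2 \<otimes>\<^bsub>affine_S4\<^esub> ?s 3 \<otimes>\<^bsub>affine_S4\<^esub> ?s 2"
      by (auto simp: affine_S4_mult fun_eq_iff transpose_def)
  qed
  then obtain h where h: "h \<in> hom B4 affine_S4" and hs: "h sigma1 = ?s 1" "h sigma2 = ?s 2" "h sigma3 = ?s 3"
    by blast
  interpret h: group_hom B4 affine_S4 h
    using h by (simp add: group_hom_def group_hom_axioms_def B4.is_group group_affine_S4)
  have "fst (h x) = braid_perm 4 x" if "x \<in> B4'" for x
  proof -
    have "(fst \<circ> h) x = braid_perm 4 x"
    proof (rule hom_eq_on_generators[OF sym_group_is_group[of 4]])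
      show "fst \<circ> h \<in> hom (presented_group {1..<4} (braid_relations 4)) (sym_group 4)"
        "braid_perm 4 \<in> hom (presented_group {1..<4} (braid_relations 4)) (sym_group 4)"
        unfolding braid_group_def[symmetric]
        using h affine_S4_hom braid_perm_hom[of 4] hom_compose by blast+
      show "x \<in> carrier (presented_group {1..<4} (braid_relations 4))"
        unfolding braid_group_def[symmetric] using that B4'_subset by blast
      fix i :: nat assume i: "i \<in> {1..<4}"
      then have "i = 1 \<or> i = 2 \<or> i = 3" by auto
      then show "(fst \<circ> h) (generator {1..<4} (braid_relations 4) i) =
          braid_perm 4 (generator {1..<4} (braid_relations 4) i)"
        using hs braid_perm_generator[OF i] by (auto simp: sigma1_def sigma2_def sigma3_def)
    qed
    then show ?thesis by simp
  qed
  moreover have "coord_sum (snd (h x)) = 0" if "x \<in> B4'" for x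
  proof -
    let ?Q = "\<lparr>carrier = UNIV, mult = (+), one = 0\<rparr> :: rat monoid"
    have Q: "comm_group ?Q"
      by (rule comm_groupI) (auto intro: exI[of _ "- _"] simp: add.assoc add.commute)
    have "coord_sum \<circ> snd \<circ> h \<in> hom B4 ?Q"
      using coord_sum_permutes h.hom_closed
      by (auto simp: hom_def affine_S4_carrier affine_S4_mult)
    then show ?thesis
      using hom_trivial_on_derived[OF B4.is_group Q, of "coord_sum \<circ> snd \<circ> h" x] that
      by (simp add: braid_commutator_subgroup_def)
  qed
  moreover have "affine_act x (h c4) \<noteq> x" for x
  proof
    assume x: "affine_act x (h c4) = x"
    have "c4 \<otimes>\<^bsub>B4\<^esub> sigma1 = sigma3"
      by (simp add: c4_def B4.m_assoc)
    then have "h sigma3 = h c4 \<otimes>\<^bsub>affine_S4\<^esub> h sigma1"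
      using h.hom_mult[of c4 sigma1] by simp
    \<comment> \<open>\<open>sigma3\<close> leaves coordinates 1 and 2 alone, while
      \<open>sigma1\<close> exchanges them and adds 1 to each. So each would exceed the other by
      1.\<close>
    then have "affine_act x (h sigma3) = affine_act x (h sigma1)"
      by (simp add: affine_act_mult x)
    then have "affine_act x (h sigma3) 1 = affine_act x (h sigma1) 1"
      "affine_act x (h sigma3) 2 = affine_act x (h sigma1) 2"
      by simp_all
    then show False
      by (simp add: hs affine_act_def transpose_def flip: numeral_2_eq_2)
  qed
  ultimately show ?thesis using h by blast
qed

section \<open>Invariance of the kernel under automorphisms\<close>

theorem corollary2:
  shows "characteristic_subgroup (braid_J 4)
    ((braid_group 4)\<lparr>carrier := braid_commutator_subgroup 4\<rparr>)"
proof -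
  let ?f = "braid_perm 4"
  interpret f: group_hom G4 "alt_group 4" ?f
    using braid_perm_G4 by (simp add: group_hom_def group_hom_axioms_def group_G4 alt_group_is_group)
  have "braid_J 4 = kernel G4 (alt_group 4) ?f"
    by (auto simp: braid_J_4 kernel_def alt_group_one)
  then have sub: "subgroup (braid_J 4) G4"
    using f.subgroup_kernel by simp
  have alt_sym: "f \<in> hom G4 (sym_group 4)" if "f \<in> hom G4 (alt_group 4)" for f
    using that by (auto simp: hom_def alt_group_def sym_group_def)
  have main: "\<phi> x \<in> braid_J 4 \<longleftrightarrow> x \<in> braid_J 4" if phi: "\<phi> \<in> auto G4" and x: "x \<in> B4'" for \<phi> x
  proof -
    have hom: "\<phi> \<in> hom G4 G4" and bij: "bij_betw \<phi> B4' B4'"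
      using phi by (auto simp: auto_def Bij_def)
    then have "\<phi> \<in> iso G4 G4" by (simp add: iso_def)
    define \<psi> where "\<psi> = inv_into B4' \<phi>"
    have psi: "\<psi> \<in> hom G4 G4"
      using G4.iso_set_sym[OF \<open>\<phi> \<in> iso G4 G4\<close>] by (simp add: iso_def \<psi>_def)
    have phi_psi: "\<phi> (\<psi> y) = y" "\<psi> y \<in> B4'" if "y \<in> B4'" for y
      using bij that by (auto simp: \<psi>_def bij_betw_inv_into_right bij_betw_def inv_into_into)
    have phi_in: "\<phi> y \<in> B4'" if "y \<in> B4'" for y
      using bij that by (auto simp: bij_betw_def)
    define f where "f = ?f \<circ> \<phi>"
    have f_alt: "f \<in> hom G4 (alt_group 4)"
      unfolding f_def using hom braid_perm_G4 hom_compose by blast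
    have A4: "f y \<in> A4" if "y \<in> B4'" for y
      using hom_in_carrier[OF f_alt, of y] that alt_group_4_subset by auto
    \<comment> \<open>Otherwise \<open>f\<close> lifts to the double cover, and composing the lift
      with \<open>\<psi>\<close> lifts \<open>?f\<close>, against
      \<open>line_cover_obstruction\<close>.\<close>
    have "f c4 \<noteq> id"
    proof
      assume "f c4 = id"
      then obtain h where h: "h \<in> hom G4 line_cover" "\<And>y. y \<in> B4' \<Longrightarrow> snd (h y) = f y"
        using lift_of_hom_trivial_on_c4[OF group_line_cover sym_group_is_group line_cover_hom _ alt_sym[OF f_alt]]
          line_cover_surj by (force simp: sym_group_one sym_group_carrier)
      have k: "h \<circ> \<psi> \<in> hom G4 line_cover"
        using h(1) psi hom_compose by blast
      have "snd ((h \<circ> \<psi>) y) = ?f y" if "y \<in> B4'" for y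
        using that h(2) phi_psi by (simp add: f_def)
      then show False
        using line_cover_obstruction[OF braid_pair_hom[OF group_G4 k braid_pair_G4]]
          braid_perm_c4 braid_perm_u4(2)[of 1] c4_u4_in_B4' by simp
    qed
    obtain h0 where h0: "h0 \<in> hom B4 affine_S4" "\<And>y. y \<in> B4' \<Longrightarrow> fst (h0 y) = ?f y"
      "\<And>y. y \<in> B4' \<Longrightarrow> coord_sum (snd (h0 y)) = 0" "\<And>v. affine_act v (h0 c4) \<noteq> v"
      using affine_rep_exists by blast
    define h where "h = h0 \<circ> \<phi>"
    have h: "h \<in> hom G4 affine_S4"
      unfolding h_def using hom hom_restrict_subgroup[OF h0(1) B4'_subset] hom_compose by blast
    interpret h: group_hom G4 affine_S4 h
      using h by (simp add: group_hom_def group_hom_axioms_def group_G4 group_affine_S4)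
    have fst_h: "fst (h y) = f y" and sum_h: "coord_sum (snd (h y)) = 0" if "y \<in> B4'" for y
      using that h0 phi_in by (simp_all add: h_def f_def)
    note pair = braid_pair_hom[OF group_G4 h braid_pair_G4]
    note c4u4 = c4_u4_in_B4'
    have alt: "fst (h c4) \<in> A4" "fst (h c4) \<noteq> id" "\<And>n. fst (h (u4 n)) \<in> A4"
      using A4 fst_h c4u4 \<open>f c4 \<noteq> id\<close> by simp_all
    have sum: "coord_sum (snd (h c4)) = 0" "\<And>n. coord_sum (snd (h (u4 n))) = 0"
      using sum_h c4u4 by simp_all
    \<comment> \<open>Otherwise some point is fixed by the whole image of \<open>h\<close>, which
      contains \<open>h (\<psi> c4) = h0 c4\<close>, a map without fixed points.\<close>
    have "h c4 \<otimes>\<^bsub>affine_S4\<^esub> h c4 \<noteq> \<one>\<^bsub>affine_S4\<^esub>"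
    proof
      assume "h c4 \<otimes>\<^bsub>affine_S4\<^esub> h c4 = \<one>\<^bsub>affine_S4\<^esub>"
      then obtain v where v: "affine_act v (h c4) = v" "\<And>n. affine_act v (h (u4 n)) = v"
        using affine_fixed_point[OF pair alt sum] by blast
      have act_one: "affine_act v \<one>\<^bsub>affine_S4\<^esub> = v"
        by (simp add: affine_act_def affine_S4_one)
      have act_inv: "affine_act v (h (inv\<^bsub>G4\<^esub> y)) = v" if "y \<in> B4'" "affine_act v (h y) = v" for y
      proof -
        have e: "h (inv\<^bsub>G4\<^esub> y) = inv\<^bsub>affine_S4\<^esub> (h y)"
          using that(1) h.hom_inv[of y] by simp
        have "affine_act v (h (inv\<^bsub>G4\<^esub> y)) = affine_act (affine_act v (h y)) (h (inv\<^bsub>G4\<^esub> y))"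
          by (simp only: that(2))
        also have "\<dots> = affine_act v (h y \<otimes>\<^bsub>affine_S4\<^esub> inv\<^bsub>affine_S4\<^esub> (h y))"
          by (simp only: e affine_act_mult)
        also have "\<dots> = v"
          using that(1) h.hom_closed[of y] group.r_inv[OF group_affine_S4] act_one by simp
        finally show ?thesis .
      qed
      have fixed: "affine_act v (h y) = v" if "y \<in> B4'" for y
      proof -
        have "y \<in> generate B4 (insert c4 (range u4))"
          using that by (simp add: B4'_eq_generate)
        then show ?thesis
        proof (induction rule: generate.induct)
          case one
          show ?case using h.hom_one act_one by simp
        next
          case (incl y)
          then show ?case using v by auto
        next
          case (inv y)
          then have y: "y \<in> B4'" "affine_act v (h y) = v" using v c4u4 by auto
          then show ?case
            using act_inv[OF y] B4.m_inv_consistent[OF subgroup_B4' y(1)] by (simp only:)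
        next
          case (eng y z)
          then have "y \<in> carrier G4" "z \<in> carrier G4" by (simp_all add: B4'_eq_generate)
          then show ?case using eng h.hom_mult[of y z] by (simp add: affine_act_mult)
        qed
      qed
      have "h (\<psi> c4) = h0 c4"
        using phi_psi c4u4 by (simp add: h_def)
      then show False
        using fixed[of "\<psi> c4"] phi_psi(2) c4u4 h0(4)[of v] by simp
    qed
    then have per: "f (u4 (n + 2)) = f (u4 n)" for n
      using affine_periodic[OF pair alt sum] fst_h c4u4 by simp
    have "f c4 \<in> V4"
      using affine_pair_V4(1)[OF pair alt sum] fst_h c4u4 by simp
    moreover have "f (u4 0) \<notin> V4"
      using affine_pair_not_V4[OF pair alt sum, of 0] fst_h c4u4 by simp
    ultimately obtain r where r: "r permutes {1..4}" "r \<circ> ?f c4 = f c4 \<circ> r" "r \<circ> ?f (u4 0) = f (u4 0) \<circ> r"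
      using conj_to_standard_pair[OF A4[OF c4u4(2)[of 0]] _ _ \<open>f c4 \<noteq> id\<close>] braid_perm_c4 braid_perm_u4(1) by auto
    have dbl: "g (u4 (n + 1)) = g (u4 n) \<circ> g (u4 (n + 2))" if "g \<in> hom G4 (alt_group 4)" for g n
      using braid_pair_hom[OF group_G4 that braid_pair_G4] by (simp add: braid_pair_def alt_group_mult)
    have r_u: "r \<circ> ?f (u4 n) = f (u4 n) \<circ> r" for n
    proof -
      \<comment> \<open>By periodicity the recurrence at 0 makes the value at \<open>u4 1\<close>
        the square of that at \<open>u4 0\<close>, for both homomorphisms.\<close>
      have "r \<circ> ?f (u4 1) = f (u4 1) \<circ> r"
        using dbl[OF braid_perm_G4, of 0] dbl[OF f_alt, of 0] per[of 0] braid_perm_u4(2)[of 0] r(3)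
        by (simp add: comp_assoc) (metis comp_assoc)
      moreover have "n mod 2 = 0 \<or> n mod 2 = 1" by presburger
      ultimately show ?thesis
        using periodic_eq_parity[of "\<lambda>n. f (u4 n)" n] periodic_eq_parity[of "\<lambda>n. ?f (u4 n)" n] per braid_perm_u4(2) r(3)
        by auto
    qed
    \<comment> \<open>\<open>k\<close> is \<open>f\<close> conjugated back by \<open>r\<close>. It
      agrees with \<open>?f\<close> on the generators of \<open>B4'\<close>, and conjugate
      homomorphisms have the same kernel.\<close>
    define k where "k = (\<lambda>y. inv' r \<circ> f y \<circ> r)"
    have rr: "r \<circ> inv' r = id" "inv' r \<circ> r = id"
      using permutes_inv_o[OF r(1)] by auto
    have "k \<in> hom G4 (sym_group 4)"
    proof (rule homI)
      show "k y \<in> carrier (sym_group 4)" if "y \<in> carrier G4" for y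
        using hom_in_carrier[OF alt_sym[OF f_alt] that] r(1)
        by (auto simp: k_def sym_group_carrier intro!: permutes_compose permutes_inv)
      show "k (y \<otimes>\<^bsub>G4\<^esub> z) = k y \<otimes>\<^bsub>sym_group 4\<^esub> k z" if "y \<in> carrier G4" "z \<in> carrier G4" for y z
      proof -
        have "k y \<circ> k z = inv' r \<circ> f y \<circ> (r \<circ> inv' r) \<circ> f z \<circ> r"
          by (simp only: k_def comp_assoc)
        then show ?thesis
          using hom_mult[OF f_alt that] by (simp add: k_def rr sym_group_mult alt_group_mult comp_assoc)
      qed
    qed
    moreover have "k y = ?f y" if "r \<circ> ?f y = f y \<circ> r" for y
    proof -
      have "k y = inv' r \<circ> (f y \<circ> r)" by (simp only: k_def comp_assoc)
      also have "\<dots> = (inv' r \<circ> r) \<circ> ?f y" by (simp only: that[symmetric] comp_assoc)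
      finally show ?thesis by (simp add: rr)
    qed
    ultimately have kf: "k y = ?f y" if "y \<in> B4'" for y
      using hom_eq_on_B4'[OF sym_group_is_group _ alt_sym[OF braid_perm_G4] _ _ that, of k] r(2) r_u by blast
    have "f x = id \<longleftrightarrow> k x = id"
    proof
      assume "k x = id"
      then have "r \<circ> (inv' r \<circ> f x \<circ> r) \<circ> inv' r = r \<circ> id \<circ> inv' r" by (simp only: k_def)
      then have "(r \<circ> inv' r) \<circ> f x \<circ> (r \<circ> inv' r) = r \<circ> inv' r" by (simp only: comp_assoc id_comp)
      then show "f x = id" by (simp add: rr)
    qed (simp add: k_def rr)
    then show ?thesis
      using kf[OF x] x phi_in[OF x] by (simp add: braid_J_4 f_def)
  qed
  have "\<phi> ` braid_J 4 = braid_J 4" if phi: "\<phi> \<in> auto G4" for \<phi>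
  proof -
    have img: "\<phi> ` B4' = B4'"
      using phi by (auto simp: auto_def Bij_def bij_betw_def)
    have J: "x \<in> B4'" if "x \<in> braid_J 4" for x
      using that by (simp add: braid_J_4)
    have "x \<in> \<phi> ` braid_J 4" if "x \<in> braid_J 4" for x
    proof -
      obtain y where "y \<in> B4'" "x = \<phi> y"
        using J[OF \<open>x \<in> braid_J 4\<close>] img by blast
      then show ?thesis
        using main[OF phi, of y] that by blast
    qed
    moreover have "\<phi> x \<in> braid_J 4" if "x \<in> braid_J 4" for x
      using main[OF phi J[OF that]] that by blast
    ultimately show ?thesis
      by blast
  qed
  then show ?thesis
    using sub by (simp add: characteristic_subgroup_def)
qed

end
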